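(* Consider, for $x\ge0$, the regularized system $$\dot x=1,\qquad \epsilon\dot v=-a\epsilon v-\big[1+(1+\psi(v))\cos\pi x\big]\sin\tfrac{\pi x}{2}.$$ For all $a,\epsilon>0$ with $a\gg1$ and $\epsilon\ll1$ (i.e. there is $a_1>0$ such that for every $a>a_1$ there is $\epsilon_0>0$ such that for every $\epsilon\in(0,\epsilon_0)$), this system has a sliding $4$-periodic solution. This solution is locally asymptotically stable, and the Lipschitz constant of the associated Poincaré (return) map is exponentially small in $\epsilon$.
   Context: $\psi:\mathbb{R}\to\mathbb{R}$ is a transition function: $C^1$ on $\mathbb{R}$ and $C^2$ on $[-1,1]$, with $\psi(v)=\operatorname{sign}(v)$ for $|v|\ge1$, $\psi'(v)>0$ for $|v|<1$, and $\operatorname{sign}\psi''(v)=-\operatorname{sign}(v)$ at $|v|=1$. The switching layer is $\{|v|<1\}$; the critical manifold inside it is $\Lambda_0^L=\{|v|<1,\ \psi(v)=-1-\sec\pi x,\ x\in(\frac23+2n,\frac43+2n)\}$, attracting for $x\in(\frac83+4n,\frac{10}{3}+4n)$. A periodic solution is sliding if part of it evolves inside the layer along (close to) $\Lambda_0^L$. *)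

theory Defs
  imports "HOL-Analysis.Analysis"
begin

definition transition_fn :: "(real \<Rightarrow> real) \<Rightarrow> bool" where
  "transition_fn \<psi> \<longleftrightarrow>
     (\<exists>\<psi>1 \<psi>2.
        (\<forall>v. (\<psi> has_real_derivative \<psi>1 v) (at v)) \<and> continuous_on UNIV \<psi>1 \<and>
        (\<forall>v\<in>{-1..1}. (\<psi>1 has_real_derivative \<psi>2 v) (at v within {-1..1})) \<and>
        continuous_on {-1..1} \<psi>2 \<and>
        (\<forall>v. \<bar>v\<bar> \<ge> 1 \<longrightarrow> \<psi> v = sgn v) \<and>
        (\<forall>v. \<bar>v\<bar> < 1 \<longrightarrow> \<psi>1 v > 0) \<and>
        sgn (\<psi>2 1) = - sgn (1::real) \<and> sgn (\<psi>2 (-1)) = - sgn (-1::real))"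

definition rhs :: "real \<Rightarrow> real \<Rightarrow> (real \<Rightarrow> real) \<Rightarrow> real \<Rightarrow> real \<Rightarrow> real" where
  "rhs a \<epsilon> \<psi> x v = - a * \<epsilon> * v - (1 + (1 + \<psi> v) * cos (pi * x)) * sin (pi * x / 2)"

text \<open>Since x' = 1 we parametrize by x(t) = t (x(0) = 0); v solves the v-equation on [0,T].\<close>
definition solves_on :: "real \<Rightarrow> real \<Rightarrow> (real \<Rightarrow> real) \<Rightarrow> real set \<Rightarrow> (real \<Rightarrow> real) \<Rightarrow> bool" where
  "solves_on a \<epsilon> \<psi> I v \<longleftrightarrow>
     (\<forall>t\<in>I. (v has_real_derivative (rhs a \<epsilon> \<psi> t (v t) / \<epsilon>)) (at t within I))"

definition poincare :: "real \<Rightarrow> real \<Rightarrow> (real \<Rightarrow> real) \<Rightarrow> real \<Rightarrow> real" where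
  "poincare a \<epsilon> \<psi> v0 = (THE w. \<exists>v. solves_on a \<epsilon> \<psi> {0..4} v \<and> v 0 = v0 \<and> v 4 = w)"

definition crit_manifold :: "(real \<Rightarrow> real) \<Rightarrow> (real \<times> real) set" where
  "crit_manifold \<psi> = {(x, v). \<bar>v\<bar> < 1 \<and> \<psi> v = -1 - 1 / cos (pi * x) \<and>
      (\<exists>n::int. 2/3 + 2 * of_int n < x \<and> x < 4/3 + 2 * of_int n)}"

definition loc_asym_stable :: "real \<Rightarrow> real \<Rightarrow> (real \<Rightarrow> real) \<Rightarrow> (real \<Rightarrow> real) \<Rightarrow> bool" where
  "loc_asym_stable a \<epsilon> \<psi> vs \<longleftrightarrow>
     (\<forall>\<eta>>0. \<exists>\<delta>>0. \<forall>w. solves_on a \<epsilon> \<psi> {0..} w \<and> \<bar>w 0 - vs 0\<bar> < \<delta> \<longrightarrow>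
         (\<forall>t\<ge>0. \<bar>w t - vs t\<bar> < \<eta>)) \<and>
     (\<exists>\<delta>>0. \<forall>w. solves_on a \<epsilon> \<psi> {0..} w \<and> \<bar>w 0 - vs 0\<bar> < \<delta> \<longrightarrow>
         ((\<lambda>t. w t - vs t) \<longlongrightarrow> 0) at_top)"

end

theory Submission
  imports Defs
begin

text \<open>
  With \<open>\<sigma> = sin (\<pi> t / 2)\<close> the equation reads
  \<open>v' = - a v - \<sigma> (1 + (1 + \<psi> v) (1 - 2 \<sigma>\<^sup>2)) / \<epsilon>\<close>. Trajectories that start in \<open>[- R, R]\<close>, \<open>R = 4 / (a \<epsilon>)\<close>,
  stay there, and for large \<open>a\<close> every time window of fixed length on which the singular term has a definite
  sign throws all of them to the same side of the layer: they are below it at time \<open>1/8\<close>, above it at \<open>17/8\<close>,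
  inside it on \<open>[35/12, 19/6]\<close> and above it at \<open>7/2\<close>. The distance of two trajectories does not grow while
  both saturate \<open>\<psi>\<close> or while the linearisation is dissipative, which leaves two intervals: on the sliding
  interval \<open>[35/12, 19/6]\<close> it shrinks by \<open>exp (- c / \<epsilon>)\<close>, and during the upward crossing of the layer just after
  \<open>t = 2\<close> it grows at most by a factor independent of \<open>\<epsilon>\<close>, because a time shift of the lower trajectory
  overtakes the upper one. So the return map contracts \<open>[- R, R]\<close> with the asserted constant, and its
  fixed point is the periodic solution.
\<close>

section \<open>Differential inequalities and global solutions\<close>

lemma diff_eq_deriv_within:
  fixes f :: "real \<Rightarrow> real"
  assumes "a < b" "\<And>t. t \<in> {a..b} \<Longrightarrow> (f has_real_derivative f' t) (at t within {a..b})"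
  obtains \<xi> where "a < \<xi>" "\<xi> < b" "f b - f a = (b - a) * f' \<xi>"
  using mvt_simple[of a b f "\<lambda>t h. h * f' t"] assms
  by (auto simp: has_field_derivative_def mult.commute[of _ "f' _"])

text \<open>After rescaling by \<open>exp (- L * t)\<close> the excess \<open>u - U\<close> has
  non-positive derivative wherever it is positive; the mean value theorem, applied from the last
  time at which it is not positive, rules out a positive final excess. As \<open>above\<close>
  allows the term \<open>L * (u t - U t)\<close>, the barrier may be another solution or an explicit
  curve.\<close>

lemma derivative_barrier:
  fixes u U :: "real \<Rightarrow> real"
  assumes "s \<le> T" "u s \<le> U s"
    and u: "\<And>t. t \<in> {s..T} \<Longrightarrow> (u has_real_derivative u' t) (at t within {s..T})"
    and U: "\<And>t. t \<in> {s..T} \<Longrightarrow> (U has_real_derivative U' t) (at t within {s..T})"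
    and above: "\<And>t. t \<in> {s..T} \<Longrightarrow> U t < u t \<Longrightarrow> u' t - U' t \<le> L * (u t - U t)"
  shows "u T \<le> U T"
proof (rule ccontr)
  define d where "d t = exp (- L * t) * (u t - U t)" for t
  define d' where "d' t = exp (- L * t) * (u' t - U' t - L * (u t - U t))" for t
  have d: "(d has_real_derivative d' t) (at t within {s..T})" if "t \<in> {s..T}" for t
    unfolding d_def d'_def
    by (rule derivative_eq_intros u[OF that] U[OF that] refl)+ (simp add: algebra_simps)
  assume "\<not> u T \<le> U T"
  then have dT: "d T > 0" by (simp add: d_def)
  define A where "A = {t \<in> {s..T}. d t \<in> {..0}}"
  have "continuous_on {s..T} d"
    using d by (meson DERIV_continuous_on)
  then have "closed A"
    using continuous_closed_preimage[of "{s..T}" d "{..0}"] by (simp add: A_def vimage_def Int_def)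
  moreover have "bounded A"
    unfolding A_def by (rule bounded_subset[of "{s..T}"]) auto
  ultimately have "compact A" by (simp add: compact_eq_bounded_closed)
  moreover have "s \<in> A" using assms(1,2) by (simp add: A_def d_def mult_le_0_iff)
  ultimately obtain r where r: "r \<in> A" "\<And>t. t \<in> A \<Longrightarrow> t \<le> r"
    using compact_attains_sup[of A] by blast
  have "r < T" using r dT by (force simp: A_def)
  have "s \<le> r" "d r \<le> 0" using r by (auto simp: A_def)
  obtain \<xi> where \<xi>: "r < \<xi>" "\<xi> < T" "d T - d r = (T - r) * d' \<xi>"
    using diff_eq_deriv_within[OF \<open>r < T\<close>, of d d'] d \<open>s \<le> r\<close>
    by (metis (no_types, lifting) DERIV_subset atLeastAtMost_iff atLeastatMost_subset_iff order.trans order_refl)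
  have "d \<xi> > 0" using r(2)[of \<xi>] \<xi> \<open>s \<le> r\<close> by (force simp: A_def)
  then have "d' \<xi> \<le> 0"
    using above[of \<xi>] \<xi> \<open>s \<le> r\<close> by (simp add: d_def d'_def zero_less_mult_iff mult_le_0_iff)
  with \<xi> have "d T \<le> d r" using mult_nonneg_nonpos[of "T - r" "d' \<xi>"] by linarith
  with dT \<open>d r \<le> 0\<close> show False by simp
qed

text \<open>The barrier is the segment from \<open>(s, R)\<close> to \<open>(T, b)\<close>: it stays
  above \<open>b\<close>, so that \<open>above\<close> applies, and it falls no faster than
  \<open>\<kappa>\<close>.\<close>

lemma push_down:
  fixes u :: "real \<Rightarrow> real"
  assumes "s < T" "u s \<le> R" "R - b \<le> \<kappa> * (T - s)" "0 \<le> \<kappa>" "b \<le> R"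
    and u: "\<And>t. t \<in> {s..T} \<Longrightarrow> (u has_real_derivative u' t) (at t within {s..T})"
    and above: "\<And>t. t \<in> {s..T} \<Longrightarrow> b < u t \<Longrightarrow> u' t \<le> - \<kappa>"
  shows "u T \<le> b"
proof -
  define U where "U t = b + (R - b) / (T - s) * (T - t)" for t
  have "u T \<le> U T"
  proof (rule derivative_barrier[where u=u and U=U and T=T and u'=u' and U'="\<lambda>_. - ((R - b) / (T - s))" and L=0 and s=s])
    fix t assume t: "t \<in> {s..T}"
    show "(U has_real_derivative - ((R - b) / (T - s))) (at t within {s..T})"
      unfolding U_def using assms(1) by (auto intro!: derivative_eq_intros simp: minus_divide_left)
    assume "U t < u t"
    moreover have "b \<le> U t" using t assms by (simp add: U_def)
    ultimately have "u' t \<le> - \<kappa>" using above[OF t] by simp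
    moreover have "(R - b) / (T - s) \<le> \<kappa>" using assms by (simp add: field_simps)
    ultimately show "u' t - - ((R - b) / (T - s)) \<le> 0 * (u t - U t)"
      by simp
  qed (use assms in \<open>auto simp: U_def\<close>)
  then show ?thesis by (simp add: U_def)
qed

lemma push_up:
  fixes u :: "real \<Rightarrow> real"
  assumes "s < T" "- R \<le> u s" "R + b \<le> \<kappa> * (T - s)" "0 \<le> \<kappa>" "- R \<le> b"
    and u: "\<And>t. t \<in> {s..T} \<Longrightarrow> (u has_real_derivative u' t) (at t within {s..T})"
    and below: "\<And>t. t \<in> {s..T} \<Longrightarrow> u t < b \<Longrightarrow> \<kappa> \<le> u' t"
  shows "b \<le> u T"
proof -
  have "- u T \<le> - b"
    by (rule push_down[where u="\<lambda>t. - u t" and u'="\<lambda>t. - u' t" and \<kappa>=\<kappa> and R=R and s=s])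
      (use assms in \<open>auto intro!: derivative_eq_intros u\<close>)
  then show ?thesis by simp
qed

text \<open>Squaring avoids the kink of the absolute value. The rate \<open>\<gamma>\<close> may be
  negative, which is how contraction is obtained.\<close>

lemma gronwall_abs:
  fixes d :: "real \<Rightarrow> real"
  assumes "s \<le> T"
    and d: "\<And>t. t \<in> {s..T} \<Longrightarrow> (d has_real_derivative d' t) (at t within {s..T})"
    and le: "\<And>t. t \<in> {s..T} \<Longrightarrow> d t * d' t \<le> \<gamma> * (d t)\<^sup>2"
  shows "\<bar>d T\<bar> \<le> exp (\<gamma> * (T - s)) * \<bar>d s\<bar>"
proof -
  have "(d T)\<^sup>2 \<le> exp (2 * \<gamma> * (T - s)) * (d s)\<^sup>2"
  proof (rule derivative_barrier[where s=s and u="\<lambda>t. (d t)\<^sup>2" and u'="\<lambda>t. 2 * (d t * d' t)" and L="2*\<gamma>"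
        and U="\<lambda>t. exp (2 * \<gamma> * (t - s)) * (d s)\<^sup>2"
        and U'="\<lambda>t. 2 * \<gamma> * (exp (2 * \<gamma> * (t - s)) * (d s)\<^sup>2)"])
    fix t assume t: "t \<in> {s..T}"
    show "((\<lambda>t. (d t)\<^sup>2) has_real_derivative 2 * (d t * d' t)) (at t within {s..T})"
      by (auto intro!: derivative_eq_intros d[OF t])
    show "((\<lambda>t. exp (2 * \<gamma> * (t - s)) * (d s)\<^sup>2) has_real_derivative
        2 * \<gamma> * (exp (2 * \<gamma> * (t - s)) * (d s)\<^sup>2)) (at t within {s..T})"
      by (auto intro!: derivative_eq_intros)
    show "2 * (d t * d' t) - 2 * \<gamma> * (exp (2 * \<gamma> * (t - s)) * (d s)\<^sup>2)
        \<le> 2 * \<gamma> * ((d t)\<^sup>2 - exp (2 * \<gamma> * (t - s)) * (d s)\<^sup>2)"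
      using le[OF t] by (simp add: algebra_simps)
  qed (use assms in auto)
  also have "\<dots> = (exp (\<gamma> * (T - s)) * \<bar>d s\<bar>)\<^sup>2"
    by (simp add: power_mult_distrib exp_double[symmetric] mult.assoc)
  finally show ?thesis
    by (metis abs_ge_zero abs_le_square_iff abs_mult abs_abs abs_exp_cancel)
qed

lemma global_solution:
  fixes f :: "real \<Rightarrow> real \<Rightarrow> real"
  assumes cont: "\<And>g. continuous_on {0..} g \<Longrightarrow> continuous_on {0..} (\<lambda>t. f t (g t))"
    and lip: "\<And>t x y. 0 \<le> t \<Longrightarrow> \<bar>f t x - f t y\<bar> \<le> L * \<bar>x - y\<bar>"
    and bd: "\<And>t. 0 \<le> t \<Longrightarrow> \<bar>f t 0\<bar> \<le> C"
    and "0 \<le> L"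
  obtains v where "v 0 = x0"
    "\<And>t. 0 \<le> t \<Longrightarrow> (v has_real_derivative f t (v t)) (at t within {0..})"
proof -
  \<comment> \<open>Conjugated by \<open>exp (k t)\<close>, the Picard operator contracts the bounded continuous functions.\<close>
  define k where "k = 2 * L + 1"
  \<comment> \<open>In the weighted norm the Picard integral has Lipschitz constant
    \<open>L / k\<close>; the summand 1 keeps \<open>k\<close> positive when
    \<open>L = 0\<close>.\<close>
  have k: "k > 0" "L / k \<le> 1/2" using \<open>0 \<le> L\<close> by (auto simp: k_def field_simps)
  have C: "0 \<le> C" using bd[of 0] by simp
  define w where "w g s = f s (exp (k * s) * g s)" for g :: "real \<Rightarrow> real" and s
  define J where "J g t = x0 + integral {0..t} (w g)" for g t
  \<comment> \<open>Bounded continuous functions live on the whole line, so negative times receive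
    the value at 0.\<close>
  define \<Phi> where "\<Phi> g t = exp (- k * max 0 t) * J g (max 0 t)" for g t
  have contw: "continuous_on {0..} (w g)" if "continuous_on {0..} g" for g
    unfolding w_def using that by (intro cont continuous_intros)
  then have contw': "continuous_on {0..t} (w g)" if "continuous_on {0..} g" for g t
    using that by (metis atLeastAtMost_iff atLeast_iff continuous_on_subset subsetI)
  have int_exp: "((\<lambda>s. exp (k * s)) has_integral (exp (k * t) - 1) / k) {0..t}" if "0 \<le> t" for t
  proof -
    have "((\<lambda>s. exp (k * s)) has_integral exp (k * t) / k - exp (k * 0) / k) {0..t}"
      using k that by (intro fundamental_theorem_of_calculus)
        (auto intro!: derivative_eq_intros simp: has_real_derivative_iff_has_vector_derivative[symmetric])
    then show ?thesis by (simp add: diff_divide_distrib)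
  qed
  \<comment> \<open>An integrand of weighted size \<open>B\<close> has an integral of weighted size
    \<open>B / k\<close>; this yields both the boundedness of \<open>\<Phi> g\<close> and the
    contraction.\<close>
  have int_bound: "exp (- k * t) * \<bar>integral {0..t} h\<bar> \<le> B / k"
    if "0 \<le> t" "0 \<le> B" "continuous_on {0..t} h" "\<And>s. s \<in> {0..t} \<Longrightarrow> \<bar>h s\<bar> \<le> B * exp (k * s)" for t h B
  proof -
    have "norm (integral {0..t} h) \<le> integral {0..t} (\<lambda>s. B * exp (k * s))"
      using that by (intro integral_norm_bound_integral integrable_continuous_real continuous_intros) auto
    also have "\<dots> = B * ((exp (k * t) - 1) / k)"
      using int_exp[OF that(1)] by (simp add: integral_unique)
    also have "\<dots> \<le> B * (exp (k * t) / k)"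
      using k that by (intro mult_left_mono divide_right_mono) auto
    finally have "exp (- k * t) * norm (integral {0..t} h) \<le> exp (- k * t) * (B * (exp (k * t) / k))"
      by (intro mult_left_mono) auto
    also have "\<dots> = B / k" by (simp add: exp_minus field_simps)
    finally show ?thesis by simp
  qed
  have derJ: "(J g has_real_derivative w g t) (at t within {0..})"
    if g: "continuous_on {0..} g" and "0 \<le> t" for g t
  proof -
    \<comment> \<open>The integral is differentiated on a compact interval; ending it beyond
      \<open>t\<close> leaves the filter at \<open>t\<close> unchanged.\<close>
    have "(J g has_real_derivative w g t) (at t within {0..t+1})"
      unfolding J_def using that
      by (auto intro!: derivative_eq_intros integral_has_real_derivative contw'[OF g])
    moreover have "at t within {0..t+1} = at t within {0..}"
      by (rule at_within_nhd[of _ "{..<t+1}"]) auto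
    ultimately show ?thesis by simp
  qed
  have contJ: "continuous_on {0..} (J g)" if "continuous_on {0..} g" for g
    using derJ[OF that] by (intro DERIV_continuous_on) auto
  have \<Phi>_bcontfun: "\<Phi> g \<in> bcontfun" if "g \<in> bcontfun" for g
  proof -
    have g: "continuous_on {0..} g" and "bounded (range g)"
      using that continuous_on_subset by (auto simp: bcontfun_def)
    then obtain N where N: "\<And>s. \<bar>g s\<bar> \<le> N" "0 \<le> N"
      by (auto simp: bounded_iff) (metis abs_ge_zero order_trans)
    show ?thesis
    proof (rule bcontfun_normI)
      show "continuous_on UNIV (\<Phi> g)"
        unfolding \<Phi>_def
        by (intro continuous_intros continuous_on_compose2[OF contJ[OF g]]) auto
      fix t :: real
      define r where "r = max 0 t"
      have r: "0 \<le> r" by (simp add: r_def)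
      have "\<bar>w g s\<bar> \<le> (C + L * N) * exp (k * s)" if "0 \<le> s" for s
      proof -
        have "\<bar>w g s\<bar> \<le> C + L * (exp (k * s) * \<bar>g s\<bar>)"
          using lip[OF that, of "exp (k * s) * g s" 0] bd[OF that] by (simp add: w_def abs_mult)
        also have "\<dots> \<le> C * exp (k * s) + L * (exp (k * s) * N)"
          using N C k that \<open>0 \<le> L\<close> by (intro add_mono mult_left_mono) (auto simp: mult_le_cancel_left1)
        finally show ?thesis by (simp add: algebra_simps)
      qed
      then have "exp (- k * r) * \<bar>integral {0..r} (w g)\<bar> \<le> (C + L * N) / k"
        using r C \<open>0 \<le> L\<close> N by (intro int_bound contw'[OF g]) auto
      moreover have "exp (- k * r) * \<bar>x0\<bar> \<le> \<bar>x0\<bar>"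
        using k r by (intro mult_left_le_one_le) auto
      moreover have "norm (\<Phi> g t) \<le> exp (- k * r) * \<bar>x0\<bar> + exp (- k * r) * \<bar>integral {0..r} (w g)\<bar>"
        by (simp add: \<Phi>_def J_def r_def abs_mult flip: distrib_left)
      ultimately show "norm (\<Phi> g t) \<le> \<bar>x0\<bar> + (C + L * N) / k" by linarith
    qed
  qed
  define F :: "(real \<Rightarrow>\<^sub>C real) \<Rightarrow> (real \<Rightarrow>\<^sub>C real)" where "F g = Bcontfun (\<Phi> g)" for g
  have F: "apply_bcontfun (F g) = \<Phi> g" for g
    unfolding F_def by (rule Bcontfun_inverse) (intro \<Phi>_bcontfun apply_bcontfun)
  have "\<exists>!g. F g = g"
  proof (rule banach_fix_type[of "1/2"], simp, simp, intro allI dist_bound)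
    fix g h :: "real \<Rightarrow>\<^sub>C real" and t :: real
    define r where "r = max 0 t"
    have r: "0 \<le> r" by (simp add: r_def)
    have cg: "continuous_on {0..r} (w g)" "continuous_on {0..r} (w h)"
      by (auto intro!: contw')
    have "\<bar>w g s - w h s\<bar> \<le> (L * dist g h) * exp (k * s)" if "0 \<le> s" for s
    proof -
      have "\<bar>w g s - w h s\<bar> \<le> L * (exp (k * s) * \<bar>g s - h s\<bar>)"
        using lip[OF that, of "exp (k * s) * g s" "exp (k * s) * h s"]
        by (simp add: w_def abs_mult flip: right_diff_distrib)
      also have "\<dots> \<le> L * (exp (k * s) * dist g h)"
        using dist_bounded[of g s h] \<open>0 \<le> L\<close> by (intro mult_left_mono) (auto simp: dist_real_def)
      finally show ?thesis by (simp add: algebra_simps)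
    qed
    then have "exp (- k * r) * \<bar>integral {0..r} (\<lambda>s. w g s - w h s)\<bar> \<le> (L * dist g h) / k"
      using r \<open>0 \<le> L\<close> by (intro int_bound continuous_intros cg) auto
    also have "\<dots> \<le> 1/2 * dist g h"
      using mult_right_mono[OF k(2), of "dist g h"] by simp
    finally show "dist (F g t) (F h t) \<le> 1/2 * dist g h"
      using cg
      by (simp add: F \<Phi>_def J_def r_def dist_real_def abs_mult integral_diff integrable_continuous_real
          flip: right_diff_distrib)
  qed
  then obtain g where "F g = g" by blast
  then have g: "g t = \<Phi> g t" for t using F by metis
  have gJ: "exp (k * t) * g t = J g t" if "0 \<le> t" for t
    using that by (subst g) (simp add: \<Phi>_def exp_minus field_simps)
  show ?thesis
  proof
    show "J g 0 = x0" by (simp add: J_def)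
    show "(J g has_real_derivative f t (J g t)) (at t within {0..})" if "0 \<le> t" for t
      using derJ[of g t] that gJ[OF that] by (simp add: w_def)
  qed
qed

section \<open>The singular term\<close>

definition half_sin :: "real \<Rightarrow> real" where "half_sin t = sin (pi * t / 2)"

text \<open>The singular term with \<open>\<psi> v\<close> replaced by a free \<open>z\<close>, so
  that estimates can hold uniformly over \<open>z\<close> in \<open>[-1, 1]\<close>, wherever the
  trajectory is.\<close>

definition drift :: "real \<Rightarrow> real \<Rightarrow> real" where
  "drift t z = half_sin t * (1 + (1 + z) * cos (pi * t))"

text \<open>The slope of \<open>drift t\<close> in \<open>z\<close>. As \<psi> is monotone, the
  singular term draws trajectories together where this is positive and can spread them only where it
  is negative.\<close>

definition gain :: "real \<Rightarrow> real" where "gain t = half_sin t * cos (pi * t)"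

lemma rhs_eq:
  "\<epsilon> \<noteq> 0 \<Longrightarrow> rhs a \<epsilon> \<psi> t v / \<epsilon> = - a * v - drift t (\<psi> v) / \<epsilon>"
  by (simp add: rhs_def drift_def half_sin_def field_simps)

lemma drift_diff: "drift t y - drift t z = gain t * (y - z)"
  by (simp add: drift_def gain_def algebra_simps)

section \<open>Symmetries and elementary bounds of the trigonometric factors\<close>

lemma cos_eq_half_sin: "cos (pi * t) = 1 - 2 * (half_sin t)\<^sup>2"
  using cos_double_sin[of "pi * t / 2"] by (simp add: half_sin_def)

lemma half_sin_shift: "half_sin (t + 2) = - half_sin t"
  unfolding half_sin_def by (simp add: distrib_left add_divide_distrib)

lemma drift_shift: "drift (t + 2) z = - drift t z"
  by (simp add: drift_def cos_eq_half_sin half_sin_shift)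

lemma drift_period: "drift (t + 4) z = drift t z"
  using drift_shift[of t z] drift_shift[of "t + 2" z] by (simp add: add.assoc)

lemma half_sin_reflect: "half_sin (2 - t) = half_sin t"
  unfolding half_sin_def by (simp add: right_diff_distrib diff_divide_distrib)

lemma half_sin_nonneg: "0 \<le> t \<Longrightarrow> t \<le> 2 \<Longrightarrow> 0 \<le> half_sin t"
  unfolding half_sin_def by (intro sin_ge_zero) auto

lemma half_sin_nonpos: "2 \<le> t \<Longrightarrow> t \<le> 4 \<Longrightarrow> half_sin t \<le> 0"
  using half_sin_nonneg[of "t - 2"] half_sin_shift[of "t - 2"] by simp

lemma half_sin_mono: "half_sin s \<le> half_sin t" if "0 \<le> s" "s \<le> t" "t \<le> 1"
  unfolding half_sin_def using that by (intro sin_monotone_2pi_le) (auto simp: mult_left_mono intro: order_trans[of _ 0])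

lemma half_sin_third: "half_sin (1/3) = 1/2"
  by (simp add: half_sin_def sin_30)

lemma sqrt3_half: "5/6 \<le> sqrt 3 / 2"
  using real_le_rsqrt[of "5/3" 3] by (simp add: power2_eq_square)

text \<open>The constant is a rational stand-in for
  \<open>cos (pi / 6) = sqrt 3 / 2\<close>.\<close>

lemma cos_ge: "5/6 \<le> cos x" if "\<bar>x\<bar> \<le> pi / 6"
  using cos_monotone_0_pi_le[of "\<bar>x\<bar>" "pi/6"] that sqrt3_half by (simp add: cos_30)

text \<open>The derivative is at least \<open>3/2 * 5/6 > 1\<close> on this range. The bound turns
  the time elapsed since a zero of the sine into a force.\<close>

lemma half_sin_ge: "t \<le> half_sin t" if "0 \<le> t" "t \<le> 1/3"
proof -
  have "half_sin 0 - 0 \<le> half_sin t - t"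
  proof (rule DERIV_nonneg_imp_nondecreasing[OF that(1)])
    fix x assume x: "0 \<le> x" "x \<le> t"
    have "\<bar>pi * x / 2\<bar> \<le> pi / 6" using x that by (simp add: abs_mult)
    then have "5/6 \<le> cos (pi * x / 2)" by (rule cos_ge)
    then have "5/6 * (3/2) \<le> cos (pi * x / 2) * (pi / 2)"
      using pi_gt3 by (intro mult_mono) auto
    moreover have "((\<lambda>t. half_sin t - t) has_real_derivative cos (pi * x / 2) * (pi / 2) - 1) (at x)"
      unfolding half_sin_def by (auto intro!: derivative_eq_intros)
    ultimately show "\<exists>y. ((\<lambda>t. half_sin t - t) has_real_derivative y) (at x) \<and> 0 \<le> y"
      by (intro exI[of _ "cos (pi * x / 2) * (pi / 2) - 1"]) simp
  qed
  then show ?thesis by (simp add: half_sin_def)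
qed

lemma half_sin_le: "half_sin t \<le> 2 * t" if "0 \<le> t"
proof -
  have "half_sin t \<le> pi * t / 2" unfolding half_sin_def using that by (intro sin_x_le_x) auto
  also have "\<dots> \<le> 4 * t / 2" using that pi_less_4 by (intro divide_right_mono mult_right_mono) auto
  finally show ?thesis by simp
qed

lemma cos_pi_nonneg: "0 \<le> cos (pi * t)" if "\<bar>t\<bar> \<le> 1/2"
proof -
  have "pi * \<bar>t\<bar> \<le> pi * (1/2)" using that by (intro mult_left_mono) auto
  then have "0 \<le> cos (pi * \<bar>t\<bar>)" by (intro cos_ge_zero) (auto intro: order_trans[of _ 0])
  then show ?thesis by (cases "0 \<le> t") auto
qed

lemma cos_pi_minus: "cos (pi * t) = - cos (pi * (t - 1))"
  by (simp add: right_diff_distrib)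

lemma cos_pi_nonneg': "0 \<le> cos (pi * t)" if "\<bar>t - 2\<bar> \<le> 1/2 \<or> \<bar>t - 4\<bar> \<le> 1/2"
  using that cos_pi_nonneg[of "t - 2"] cos_pi_nonneg[of "t - 4"]
    cos_pi_minus[of t] cos_pi_minus[of "t - 1"] cos_pi_minus[of "t - 2"] cos_pi_minus[of "t - 3"]
  by auto

lemma cos_pi_nonpos: "cos (pi * t) \<le> 0" if "\<bar>t - 3\<bar> \<le> 1/2"
  using that cos_pi_nonneg[of "t - 3"] cos_pi_minus[of t] cos_pi_minus[of "t - 1"]
    cos_pi_minus[of "t - 2"] by auto

section \<open>Sign and size of the singular term on the time windows\<close>

lemma drift_abs_le: "\<bar>drift t z\<bar> \<le> 3" if "-1 \<le> z" "z \<le> 1"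
proof -
  have "\<bar>(1 + z) * cos (pi * t)\<bar> \<le> 2 * 1"
    unfolding abs_mult using that by (intro mult_mono) auto
  then have "\<bar>1 + (1 + z) * cos (pi * t)\<bar> \<le> 3" by linarith
  then have "\<bar>drift t z\<bar> \<le> 1 * 3"
    unfolding drift_def abs_mult by (intro mult_mono) (auto simp: half_sin_def)
  then show ?thesis by simp
qed

lemma gain_abs_le: "\<bar>gain t\<bar> \<le> 1"
  unfolding gain_def abs_mult half_sin_def by (intro mult_le_one) auto

lemma gain_nonneg: "0 \<le> gain t" if "0 \<le> t \<and> t \<le> 1/2 \<or> 5/2 \<le> t \<and> t \<le> 7/2"
  using that
proof
  assume "0 \<le> t \<and> t \<le> 1/2"
  then show ?thesis unfolding gain_def by (intro mult_nonneg_nonneg half_sin_nonneg cos_pi_nonneg) auto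
next
  assume "5/2 \<le> t \<and> t \<le> 7/2"
  moreover from this have "\<bar>t - 3\<bar> \<le> 1/2" by linarith
  ultimately show ?thesis
    unfolding gain_def by (intro mult_nonpos_nonpos half_sin_nonpos cos_pi_nonpos) auto
qed

text \<open>The cosine is non-negative here, so the bracket is at least 1 for every \<open>z\<close>
  and the sine alone sets the force.\<close>

lemma drift_push_down: "1/16 \<le> drift t z" if "1/16 \<le> t" "t \<le> 1/8" "-1 \<le> z"
proof -
  have "1/16 * 1 \<le> drift t z"
    unfolding drift_def using half_sin_ge[of t] cos_pi_nonneg[of t] that by (intro mult_mono) auto
  then show ?thesis by simp
qed

lemma drift_push_up: "drift t z \<le> - (1/16)" if "33/16 \<le> t" "t \<le> 17/8" "-1 \<le> z"
  using drift_push_down[of "t - 2" z] drift_shift[of "t - 2" z] that by simp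

lemma drift_minus_one: "drift t (-1) = half_sin t"
  by (simp add: drift_def)

lemma drift_nonpos: "drift t z \<le> 0" if "2 \<le> t \<and> t \<le> 5/2 \<or> 7/2 \<le> t \<and> t \<le> 4" "-1 \<le> z"
proof -
  have "\<bar>t - 2\<bar> \<le> 1/2 \<or> \<bar>t - 4\<bar> \<le> 1/2" using that(1) by linarith
  then have "0 \<le> (1 + z) * cos (pi * t)"
    using that(2) by (intro mult_nonneg_nonneg cos_pi_nonneg') auto
  then show ?thesis
    unfolding drift_def using that(1) by (intro mult_nonpos_nonneg half_sin_nonpos) auto
qed

text \<open>The critical manifold ends at \<open>10/3\<close>, before this window. The cosine is at
  most 1/3 in absolute value here, which keeps the bracket above 1/3 for every
  \<open>z\<close>.\<close>

lemma drift_push_out: "drift t z \<le> - (1/16)" if "41/12 \<le> t" "t \<le> 7/2" "-1 \<le> z" "z \<le> 1"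
proof -
  have "1/2 \<le> half_sin (4 - t)"
    using half_sin_mono[of "1/3" "4 - t"] that by (simp add: half_sin_third)
  then have half_sin: "1/2 \<le> - half_sin t"
    using half_sin_reflect[of "t - 2"] half_sin_shift[of "t - 2"] by simp
  have "cos (pi * t) = - cos (pi * (t - 3))"
    using cos_pi_minus[of t] cos_pi_minus[of "t - 1"] cos_pi_minus[of "t - 2"] by simp
  moreover have "cos (pi * (t - 3)) = sin (pi * (7/2 - t))"
    by (simp add: sin_cos_eq right_diff_distrib mult.commute)
  moreover have "sin (pi * (7/2 - t)) \<le> 1/3"
  proof -
    have "sin (pi * (7/2 - t)) \<le> pi * (7/2 - t)"
      using that by (intro sin_x_le_x) auto
    also have "\<dots> \<le> 4 * (1/12)"
      using that pi_less_4 by (intro mult_mono) auto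
    finally show ?thesis by simp
  qed
  ultimately have "(1 + z) * (- cos (pi * t)) \<le> 2 * (1/3)"
    using that cos_pi_nonpos[of t] by (intro mult_mono) auto
  then have "1/2 * (1/3) \<le> - half_sin t * (1 + (1 + z) * cos (pi * t))"
    using half_sin by (intro mult_mono) auto
  then show ?thesis by (simp add: drift_def)
qed

section \<open>The singular term on the sliding window around time 3\<close>

lemma slide_bounds:
  assumes "17/6 \<le> t" "t \<le> 19/6"
  shows "cos (pi * t) \<le> - (5/6)" "1/2 \<le> gain t"
proof -
  have t: "\<bar>t - 3\<bar> \<le> 1/6" using assms by linarith
  have *: "\<bar>pi * (t - 3)\<bar> \<le> pi / 6" "\<bar>pi * (t - 3) / 2\<bar> \<le> pi / 6"
    using t mult_left_mono[OF t, of pi] by (auto simp: abs_mult)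
  show c: "cos (pi * t) \<le> - (5/6)"
    using cos_ge[OF *(1)] cos_pi_minus[of t] cos_pi_minus[of "t - 1"] cos_pi_minus[of "t - 2"] by simp
  have "half_sin t = - half_sin (t - 2)" using half_sin_shift[of "t - 2"] by simp
  also have "half_sin (t - 2) = cos (pi * (t - 3) / 2)"
  proof -
    have "pi * (t - 2) / 2 = pi / 2 + pi * (t - 3) / 2" by (simp add: field_simps)
    then show ?thesis by (simp only: half_sin_def sin_add sin_pi_half cos_pi_half)
  qed
  finally have s: "5/6 \<le> - half_sin t" using cos_ge[OF *(2)] by simp
  have "5/6 * (5/6) \<le> - half_sin t * (- cos (pi * t))" using c s by (intro mult_mono) auto
  then show "1/2 \<le> gain t" by (simp add: gain_def)
qed

text \<open>The value of \<psi> on the critical manifold, that is, the zero of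
  \<open>drift t\<close> in \<open>z\<close>.\<close>

definition crit_val :: "real \<Rightarrow> real" where "crit_val t = - 1 - 1 / cos (pi * t)"

lemma drift_slide: "17/6 \<le> t \<Longrightarrow> t \<le> 19/6 \<Longrightarrow> drift t z = gain t * (z - crit_val t)"
  using slide_bounds[of t] by (auto simp: drift_def gain_def crit_val_def field_simps)

text \<open>What matters is the margin to the values -1/2 and 1/2 of \<psi> at \<open>ql\<close> and
  \<open>qr\<close>: at least 1/4 on either side, enough to trap trajectories between these
  points.\<close>

lemma crit_val_bounds: "0 \<le> crit_val t" "crit_val t \<le> 1/4" if "17/6 \<le> t" "t \<le> 19/6"
  using slide_bounds[of t] cos_ge_minus_one[of "pi * t"] that by (auto simp: crit_val_def field_simps)

definition crit_val' :: "real \<Rightarrow> real" where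
  "crit_val' t = - (pi * sin (pi * t)) / (cos (pi * t))\<^sup>2"

lemma crit_val_deriv:
  assumes "17/6 \<le> t" "t \<le> 19/6"
  shows "(crit_val has_real_derivative crit_val' t) (at t within S)"
proof -
  have "cos (pi * t) \<noteq> 0" using slide_bounds[OF assms] by auto
  then show ?thesis
    unfolding crit_val_def crit_val'_def by (auto intro!: derivative_eq_intros simp: power2_eq_square)
qed

lemma crit_val'_abs_le:
  assumes "17/6 \<le> t" "t \<le> 19/6"
  shows "\<bar>crit_val' t\<bar> \<le> 8"
proof -
  have "(5/6)\<^sup>2 \<le> (- cos (pi * t))\<^sup>2"
    using slide_bounds[OF assms] by (intro power_mono) auto
  moreover have "pi * \<bar>sin (pi * t)\<bar> \<le> 4 * 1" using pi_less_4 by (intro mult_mono) auto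
  ultimately have "\<bar>crit_val' t\<bar> \<le> 4 / (5/6)\<^sup>2"
    unfolding crit_val'_def by (auto simp: abs_mult intro!: frac_le)
  then show ?thesis by (simp add: power2_eq_square)
qed

text \<open>In terms of the sine \<open>\<sigma>\<close> of the half angle, \<open>drift\<close> is the cubic
  \<open>\<sigma> (1 + P - 2 P \<sigma>\<^sup>2)\<close> with \<open>P = 1 + z\<close>, which increases on \<open>[0, 1/2]\<close>.\<close>

lemma drift_antimono:
  assumes "2 \<le> s" "s \<le> t" "t \<le> 7/3" "-1 \<le> z" "z \<le> 1"
  shows "drift t z \<le> drift s z"
proof -
  define x y P where "x = half_sin (s - 2)" and "y = half_sin (t - 2)" and "P = 1 + z"
  have xy: "0 \<le> x" "x \<le> y" "y \<le> 1/2"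
    using half_sin_nonneg[of "s - 2"] half_sin_mono[of "s - 2" "t - 2"] half_sin_mono[of "t - 2" "1/3"] assms
    by (auto simp: x_def y_def half_sin_third)
  have P: "0 \<le> P" "P \<le> 2" using assms by (auto simp: P_def)
  have "x * x \<le> 1/2 * (1/2)" "x * y \<le> 1/2 * (1/2)" "y * y \<le> 1/2 * (1/2)"
    using xy by (intro mult_mono; linarith)+
  then have "P * (x * x + x * y + y * y) \<le> P * (3/4)"
    using P by (intro mult_left_mono) auto
  then have "0 \<le> (y - x) * (1 + P - 2 * (P * (x * x + x * y + y * y)))"
    using xy P by (intro mult_nonneg_nonneg) auto
  then have "drift (s - 2) z \<le> drift (t - 2) z"
    unfolding drift_def cos_eq_half_sin x_def[symmetric] y_def[symmetric] P_def[symmetric]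
    by (simp add: algebra_simps power2_eq_square)
  then show ?thesis using drift_shift[of "s - 2" z] drift_shift[of "t - 2" z] by simp
qed

section \<open>Trajectories\<close>

text \<open>The derivative of \<psi> degenerates at the edges of the layer. The band from
  \<open>ql\<close> to \<open>qr\<close> keeps away from them, so a slope bound \<open>m\<close>
  exists there, yet it is wide enough to contain the sliding motion.\<close>

locale transition =
  fixes \<psi> \<psi>1 :: "real \<Rightarrow> real" and M m ql qr :: real
  assumes psi_deriv: "(\<psi> has_real_derivative \<psi>1 v) (at v)"
    and psi_hi: "1 \<le> v \<Longrightarrow> \<psi> v = 1" and psi_lo: "v \<le> - 1 \<Longrightarrow> \<psi> v = - 1"
    and psi_mono: "x \<le> y \<Longrightarrow> \<psi> x \<le> \<psi> y"
    and M_pos: "0 < M" and psi_lip: "x \<le> y \<Longrightarrow> \<psi> y - \<psi> x \<le> M * (y - x)"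
    and psi1_le: "\<bar>v\<bar> \<le> 1 \<Longrightarrow> \<bar>\<psi>1 v\<bar> \<le> M"
    and ql: "- 1 < ql" "\<psi> ql = - 1/2" and qr: "qr < 1" "\<psi> qr = 1/2"
    and m_pos: "0 < m" and psi1_ge: "ql \<le> v \<Longrightarrow> v \<le> qr \<Longrightarrow> m \<le> \<psi>1 v"

lemma transition_fn_imp_transition:
  assumes "transition_fn \<psi>"
  obtains \<psi>1 M m ql qr where "transition \<psi> \<psi>1 M m ql qr"
proof -
  from assms obtain \<psi>1 where d: "\<And>v. (\<psi> has_real_derivative \<psi>1 v) (at v)"
    and c: "continuous_on UNIV \<psi>1" and sat: "\<And>v. \<bar>v\<bar> \<ge> 1 \<Longrightarrow> \<psi> v = sgn v"
    and pos: "\<And>v. \<bar>v\<bar> < 1 \<Longrightarrow> \<psi>1 v > 0"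
    unfolding transition_fn_def by blast
  have cont: "continuous_on S \<psi>" for S
    using d by (meson DERIV_continuous_on DERIV_subset subset_UNIV)
  have hi: "\<psi> v = 1" if "1 \<le> v" for v using sat[of v] that by simp
  have lo: "\<psi> v = - 1" if "v \<le> - 1" for v using sat[of v] that by simp
  \<comment> \<open>As \<psi> is constant on either side of the layer, clamping reduces monotonicity
    and the Lipschitz bound to arguments in \<open>[-1, 1]\<close>.\<close>
  define cl where "cl v = max (-1) (min 1 v)" for v :: real
  have cl: "\<psi> v = \<psi> (cl v)" for v
    by (auto simp: cl_def max_def min_def hi lo)
  have strict: "\<psi> x < \<psi> y" if "-1 \<le> x" "x < y" "y \<le> 1" for x y
    by (rule DERIV_pos_imp_increasing_open[OF that(2)]) (use that d pos cont in \<open>force+\<close>)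
  have mono: "\<psi> x \<le> \<psi> y" if "x \<le> y" for x y
  proof -
    have "cl x \<le> cl y" "-1 \<le> cl x" "cl y \<le> 1" using that by (auto simp: cl_def)
    then show ?thesis using strict[of "cl x" "cl y"] cl[of x] cl[of y] by (cases "cl x = cl y") auto
  qed
  have "compact (\<psi>1 ` {-1..1})"
    using c by (intro compact_continuous_image continuous_on_subset[OF c]) auto
  then obtain M where M: "0 < M" "\<And>v. \<bar>v\<bar> \<le> 1 \<Longrightarrow> \<bar>\<psi>1 v\<bar> \<le> M"
    using compact_imp_bounded[THEN bounded_pos[THEN iffD1]] by (force simp: abs_le_iff)
  have lip: "\<psi> y - \<psi> x \<le> M * (y - x)" if "x \<le> y" for x y
  proof (cases "cl x < cl y")
    case True
    then obtain \<xi> where \<xi>: "cl x < \<xi>" "\<xi> < cl y" "\<psi> (cl y) - \<psi> (cl x) = (cl y - cl x) * \<psi>1 \<xi>"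
      using MVT2[of "cl x" "cl y" \<psi> \<psi>1] d by auto
    have "\<bar>\<xi>\<bar> \<le> 1" using \<xi> by (auto simp: cl_def)
    then have "(cl y - cl x) * \<psi>1 \<xi> \<le> (cl y - cl x) * M"
      using M(2)[of \<xi>] True by (intro mult_left_mono) auto
    also have "\<dots> \<le> (y - x) * M"
      using M(1) that by (intro mult_right_mono) (auto simp: cl_def)
    finally show ?thesis using \<xi> cl[of x] cl[of y] by (simp add: mult.commute)
  next
    case False
    then have "cl x = cl y" using that by (auto simp: cl_def)
    then have "\<psi> x = \<psi> y" using cl by metis
    then show ?thesis using M that by simp
  qed
  obtain ql where ql: "-1 \<le> ql" "ql \<le> 1" "\<psi> ql = -1/2"
    using IVT'[of \<psi> "-1" "-1/2" 1] hi[of 1] lo[of "-1"] cont by auto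
  obtain qr where qr: "-1 \<le> qr" "qr \<le> 1" "\<psi> qr = 1/2"
    using IVT'[of \<psi> "-1" "1/2" 1] hi[of 1] lo[of "-1"] cont by auto
  have "ql \<noteq> -1" "qr \<noteq> 1" using ql qr hi[of 1] lo[of "-1"] by auto
  then have q: "-1 < ql" "qr < 1" using ql qr by auto
  have "ql \<le> qr" using mono[of qr ql] ql qr by (cases "ql \<le> qr") auto
  then obtain p where p: "p \<in> {ql..qr}" "\<And>v. v \<in> {ql..qr} \<Longrightarrow> \<psi>1 p \<le> \<psi>1 v"
    using continuous_attains_inf[of "{ql..qr}" \<psi>1] continuous_on_subset[OF c] by auto
  \<comment> \<open>The minimum over a compact part of the open layer is positive and serves as
    \<open>m\<close>.\<close>
  have "0 < \<psi>1 p" using p(1) q by (intro pos) auto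
  have "transition \<psi> \<psi>1 M (\<psi>1 p) ql qr"
    by unfold_locales (use d hi lo mono M lip ql qr q p \<open>0 < \<psi>1 p\<close> in auto)
  then show ?thesis ..
qed

context transition begin

lemma psi_range: "- 1 \<le> \<psi> v" "\<psi> v \<le> 1"
  using psi_mono[of "min v (-1)" v] psi_mono[of v "max v 1"] psi_hi[of "max v 1"] psi_lo[of "min v (-1)"]
  by auto

lemma ql_less_qr: "ql < qr"
  using psi_mono[of qr ql] ql qr by (cases "ql < qr") auto

lemma drift_lip: "\<bar>drift t (\<psi> x) - drift t (\<psi> y)\<bar> \<le> M * \<bar>x - y\<bar>"
proof -
  have "\<bar>\<psi> x - \<psi> y\<bar> \<le> M * \<bar>x - y\<bar>"
    using psi_lip[of x y] psi_lip[of y x] psi_mono[of x y] psi_mono[of y x] by (cases "x \<le> y") auto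
  then have "\<bar>gain t\<bar> * \<bar>\<psi> x - \<psi> y\<bar> \<le> 1 * (M * \<bar>x - y\<bar>)"
    using gain_abs_le[of t] by (intro mult_mono) auto
  then show ?thesis by (simp add: drift_diff abs_mult)
qed

lemma psi_cont: "continuous_on S \<psi>"
  using psi_deriv by (meson DERIV_continuous_on DERIV_subset subset_UNIV)

lemma psi_ge_linear:
  assumes "ql \<le> x" "x \<le> qr" "ql \<le> y" "y \<le> qr"
  shows "m * \<bar>x - y\<bar> \<le> \<bar>\<psi> x - \<psi> y\<bar>"
proof -
  have *: "m * (y - x) \<le> \<psi> y - \<psi> x" if xy: "ql \<le> x" "x < y" "y \<le> qr" for x y
  proof -
    obtain \<xi> where \<xi>: "x < \<xi>" "\<xi> < y" "\<psi> y - \<psi> x = (y - x) * \<psi>1 \<xi>"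
      using MVT2[of x y \<psi> \<psi>1] xy psi_deriv by auto
    have "m \<le> \<psi>1 \<xi>" using \<xi> that by (intro psi1_ge) auto
    then show ?thesis using \<xi> that by (simp add: mult.commute mult_left_mono)
  qed
  show ?thesis
    using *[of x y] *[of y x] assms by (cases x y rule: linorder_cases) auto
qed

end

text \<open>Large \<open>a\<close> makes the trapping interval short enough to be crossed within
  time 1/16 (\<open>R_plus_b\<close>). Small \<open>\<epsilon>\<close> ensures that decay from
  \<open>b\<close> at rate \<open>a\<close> over three time units still leaves 2
  (\<open>b_exp\<close>).\<close>

locale flow = transition +
  fixes a \<epsilon> :: real
  assumes a_ge: "2560 \<le> a" and eps_pos: "0 < \<epsilon>" and eps_le: "\<epsilon> \<le> exp (- 3 * a) / (64 * a)"
begin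

definition f :: "real \<Rightarrow> real \<Rightarrow> real" where "f t v = - a * v - drift t (\<psi> v) / \<epsilon>"

text \<open>At this distance the damping is \<open>4 / \<epsilon>\<close>, more than the singular
  term, which is at most \<open>3 / \<epsilon>\<close>.\<close>

definition R :: real where "R = 4 / (a * \<epsilon>)"
text \<open>At this level the damping is \<open>1 / (32 * \<epsilon>)\<close>, half of the force
  \<open>1 / (16 * \<epsilon>)\<close> available in the push windows; the other half remains as
  speed.\<close>

definition b :: real where "b = 1 / (32 * a * \<epsilon>)"
text \<open>Until time \<open>2 + \<delta>\<close> the upward forcing is too weak to lift a trajectory from below \<open>- b\<close>, where it
  is at time \<open>1/8\<close>, to the layer.\<close>
definition \<delta> :: real where "\<delta> = exp (- 3 * a) / 128"

definition trajectory :: "(real \<Rightarrow> real) \<Rightarrow> bool" where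
  "trajectory v \<longleftrightarrow> solves_on a \<epsilon> \<psi> {0..4} v \<and> \<bar>v 0\<bar> \<le> R"

lemma solves_on_iff:
  "solves_on a \<epsilon> \<psi> I v \<longleftrightarrow> (\<forall>t\<in>I. (v has_real_derivative f t (v t)) (at t within I))"
  using eps_pos by (simp add: solves_on_def f_def rhs_eq)

lemma solves_on_deriv:
  "solves_on a \<epsilon> \<psi> I v \<Longrightarrow> J \<subseteq> I \<Longrightarrow> t \<in> J \<Longrightarrow> (v has_real_derivative f t (v t)) (at t within J)"
  unfolding solves_on_iff by (meson DERIV_subset subsetD)

lemma trajectory_deriv:
  "trajectory v \<Longrightarrow> 0 \<le> s \<Longrightarrow> T \<le> 4 \<Longrightarrow> t \<in> {s..T} \<Longrightarrow> (v has_real_derivative f t (v t)) (at t within {s..T})"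
  unfolding trajectory_def by (rule solves_on_deriv) auto

lemma a_pos: "0 < a" using a_ge by simp
lemma R_pos: "0 < R" using a_pos eps_pos by (simp add: R_def)
lemma exp_small: "exp (- 3 * a) \<le> 1" using a_pos by simp
lemma delta: "0 < \<delta>" "\<delta> \<le> 1/128" using exp_small by (auto simp: \<delta>_def)

lemma b_exp: "2 \<le> b * exp (- 3 * a)"
  using eps_le a_pos eps_pos by (simp add: b_def field_simps)

lemma b_ge: "2 \<le> b"
proof -
  have "b * exp (- 3 * a) \<le> b * 1"
    using exp_small a_pos eps_pos by (intro mult_left_mono) (auto simp: b_def)
  then show ?thesis using b_exp by simp
qed

lemma a_times_b: "a * b = 1 / (32 * \<epsilon>)"
  using a_pos by (simp add: b_def)

lemma a_times_R: "a * R = 4 / \<epsilon>"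
  using a_pos by (simp add: R_def)

lemma a_le: "a \<le> 1 / (64 * \<epsilon>)"
  using b_ge a_times_b a_pos mult_left_mono[of 2 b a] by (simp add: field_simps)

text \<open>Compares the longest way, from \<open>R\<close> down to \<open>- b\<close> or from
  \<open>- R\<close> up to \<open>b\<close>, with the distance covered at speed
  \<open>1 / (32 * \<epsilon>)\<close> in a window of length 1/16.\<close>

lemma R_plus_b: "R + b \<le> 1 / (32 * \<epsilon>) * (1/16)"
proof -
  have "R + b = (129/32) / a * (1 / \<epsilon>)" by (simp add: R_def b_def field_simps)
  also have "\<dots> \<le> 1/512 * (1 / \<epsilon>)"
    using eps_pos a_ge by (intro mult_right_mono) (auto simp: field_simps)
  finally show ?thesis by simp
qed

lemma b_le_R: "b \<le> R"
  using a_pos eps_pos by (simp add: R_def b_def field_simps)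

lemma f_le:
  assumes "h \<le> drift t (\<psi> v)" "x \<le> v"
  shows "f t v \<le> - (a * x) - h / \<epsilon>"
proof -
  have "h / \<epsilon> \<le> drift t (\<psi> v) / \<epsilon>" "a * x \<le> a * v"
    using assms eps_pos a_pos by (auto intro: divide_right_mono)
  then show ?thesis by (simp add: f_def)
qed

lemma f_ge:
  assumes "drift t (\<psi> v) \<le> h" "v \<le> x"
  shows "- (a * x) - h / \<epsilon> \<le> f t v"
proof -
  have "drift t (\<psi> v) / \<epsilon> \<le> h / \<epsilon>" "a * v \<le> a * x"
    using assms eps_pos a_pos by (auto intro: divide_right_mono)
  then show ?thesis by (simp add: f_def)
qed

lemma drift_psi_abs_le: "- 3 \<le> drift t (\<psi> v)" "drift t (\<psi> v) \<le> 3"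
  using drift_abs_le[OF psi_range, of t v] by auto

text \<open>The damping has the favourable sign, so \<open>a\<close> does not enter. This constant
  is the \<open>L\<close> of the barrier arguments that compare with \<open>f\<close>.\<close>

lemma f_diff_le: "x \<le> y \<Longrightarrow> f t y - f t x \<le> M / \<epsilon> * (y - x)"
proof -
  assume "x \<le> y"
  then have "(drift t (\<psi> x) - drift t (\<psi> y)) / \<epsilon> \<le> M * (y - x) / \<epsilon>" "a * x \<le> a * y"
    using drift_lip[of t x y] eps_pos a_pos by (auto intro!: divide_right_mono)
  then show ?thesis by (simp add: f_def diff_divide_distrib)
qed

section \<open>Trapping of trajectories and their position relative to the layer\<close>

lemma trajectory_bound:
  assumes v: "trajectory v" and "0 \<le> t" "t \<le> 4"
  shows "\<bar>v t\<bar> \<le> R"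
proof (cases "t = 0")
  case False
  then have t: "0 < t" using assms by simp
  note d = trajectory_deriv[OF v, of 0 t]
  have "v t \<le> R"
  proof (rule push_down[where s=0 and T=t and u=v and R=R and \<kappa>="1 / \<epsilon>" and u'="\<lambda>t. f t (v t)"])
    fix s assume "R < v s"
    then show "f s (v s) \<le> - (1 / \<epsilon>)"
      using f_le[of "-3" s "v s" R] drift_psi_abs_le a_times_R by (simp add: add_divide_distrib[symmetric])
  qed (use v t assms eps_pos in \<open>auto simp: trajectory_def intro!: d\<close>)
  moreover have "- R \<le> v t"
  proof (rule push_up[where s=0 and T=t and u=v and R=R and \<kappa>="1 / \<epsilon>" and u'="\<lambda>t. f t (v t)"])
    fix s assume "v s < - R"
    then show "1 / \<epsilon> \<le> f s (v s)"
      using f_ge[of s "v s" 3 "- R"] drift_psi_abs_le a_times_R by (simp add: diff_divide_distrib[symmetric])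
  qed (use v t assms eps_pos in \<open>auto simp: trajectory_def intro!: d\<close>)
  ultimately show ?thesis by simp
qed (use v in \<open>auto simp: trajectory_def\<close>)

text \<open>Beyond \<open>7/8 * R\<close> the damping still exceeds the singular term by
  \<open>1 / (2 * \<epsilon>)\<close>. The gain of \<open>R / 8\<close> gives the fixed point a
  neighbourhood inside the trapping interval.\<close>

lemma trajectory_end_bound:
  assumes v: "trajectory v"
  shows "\<bar>v 4\<bar> \<le> 7/8 * R"
proof -
  note d = trajectory_deriv[OF v, of 0 4]
  have R: "R - 7/8 * R \<le> 1 / (2 * \<epsilon>) * 4"
    using a_ge eps_pos by (simp add: R_def field_simps)
  have aR: "a * (7/8 * R) = (7/2) / \<epsilon>" using a_times_R by simp
  have "v 4 \<le> 7/8 * R"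
  proof (rule push_down[where s=0 and T=4 and u=v and R=R and \<kappa>="1 / (2 * \<epsilon>)" and u'="\<lambda>t. f t (v t)"])
    fix s assume "7/8 * R < v s"
    then have "f s (v s) \<le> - ((7/2) / \<epsilon>) - (- 3) / \<epsilon>"
      using f_le[of "-3" s "v s" "7/8 * R"] drift_psi_abs_le unfolding aR by simp
    then show "f s (v s) \<le> - (1 / (2 * \<epsilon>))" by simp
  qed (use v R eps_pos R_pos in \<open>auto simp: trajectory_def intro!: d\<close>)
  moreover have "- (7/8 * R) \<le> v 4"
  proof (rule push_up[where s=0 and T=4 and u=v and R=R and \<kappa>="1 / (2 * \<epsilon>)" and u'="\<lambda>t. f t (v t)"])
    fix s assume "v s < - (7/8 * R)"
    then have "(7/2) / \<epsilon> - 3 / \<epsilon> \<le> f s (v s)"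
      using f_ge[of s "v s" 3 "- (7/8 * R)"] drift_psi_abs_le aR by simp
    then show "1 / (2 * \<epsilon>) \<le> f s (v s)" by simp
  qed (use v R eps_pos R_pos in \<open>auto simp: trajectory_def intro!: d\<close>)
  ultimately show ?thesis by simp
qed

text \<open>On a window of fixed length where \<open>drift\<close> has a definite sign, the fast dynamics overrides whatever
  position the trajectory had before.\<close>

lemma pushed_down:
  assumes v: "trajectory v" and "0 \<le> s" "s + 1/16 \<le> T" "T \<le> 4"
    and drift: "\<And>t z. s \<le> t \<Longrightarrow> t \<le> T \<Longrightarrow> - 1 \<le> z \<Longrightarrow> z \<le> 1 \<Longrightarrow> 1/16 \<le> drift t z"
  shows "v T \<le> - b"
proof (rule push_down[where s=s and R=R and u=v and \<kappa>="1 / (32 * \<epsilon>)" and u'="\<lambda>t. f t (v t)"])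
  fix t assume "t \<in> {s..T}" "- b < v t"
  then have "f t (v t) \<le> a * b - (1/16) / \<epsilon>"
    using f_le[of "1/16" t "v t" "- b"] drift[of t "\<psi> (v t)"] psi_range by auto
  then show "f t (v t) \<le> - (1 / (32 * \<epsilon>))" unfolding a_times_b by (simp add: field_simps)
next
  have "1 / (32 * \<epsilon>) * (1/16) \<le> 1 / (32 * \<epsilon>) * (T - s)"
    using assms eps_pos by (intro mult_left_mono) auto
  then show "R - - b \<le> 1 / (32 * \<epsilon>) * (T - s)" using R_plus_b by simp
qed (use assms eps_pos b_ge R_pos trajectory_bound[OF v, of s] in
    \<open>auto intro!: trajectory_deriv[OF v]\<close>)

lemma pushed_up:
  assumes v: "trajectory v" and "0 \<le> s" "s + 1/16 \<le> T" "T \<le> 4"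
    and drift: "\<And>t z. s \<le> t \<Longrightarrow> t \<le> T \<Longrightarrow> - 1 \<le> z \<Longrightarrow> z \<le> 1 \<Longrightarrow> drift t z \<le> - (1/16)"
  shows "b \<le> v T"
proof (rule push_up[where s=s and R=R and u=v and \<kappa>="1 / (32 * \<epsilon>)" and u'="\<lambda>t. f t (v t)"])
  fix t assume "t \<in> {s..T}" "v t < b"
  then have "- (a * b) + (1/16) / \<epsilon> \<le> f t (v t)"
    using f_ge[of t "v t" "- (1/16)" b] drift[of t "\<psi> (v t)"] psi_range by auto
  then show "1 / (32 * \<epsilon>) \<le> f t (v t)" unfolding a_times_b by (simp add: field_simps)
next
  have "1 / (32 * \<epsilon>) * (1/16) \<le> 1 / (32 * \<epsilon>) * (T - s)"
    using assms eps_pos by (intro mult_left_mono) auto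
  then show "R + b \<le> 1 / (32 * \<epsilon>) * (T - s)" using R_plus_b by simp
qed (use assms eps_pos b_ge R_pos trajectory_bound[OF v, of s] in
    \<open>auto intro!: trajectory_deriv[OF v]\<close>)

lemma low_at_eighth: "trajectory v \<Longrightarrow> v (1/8) \<le> - b"
  by (rule pushed_down[of v "1/16"]) (assumption | rule drift_push_down | simp)+

lemma high_at_17_8: "trajectory v \<Longrightarrow> b \<le> v (17/8)"
  by (rule pushed_up[of v "33/16"]) (assumption | rule drift_push_up | simp)+

lemma high_at_7_2: "trajectory v \<Longrightarrow> b \<le> v (7/2)"
  by (rule pushed_up[of v "41/12"]) (assumption | rule drift_push_out | simp)+

lemma exp_ge_small: "r \<le> 3 \<Longrightarrow> b * exp (- 3 * a) \<le> b * exp (- a * r)"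
  using a_pos b_ge by (intro mult_left_mono) auto

text \<open>Below the layer \<psi> is -1 and the equation is linear. \<open>U\<close> solves it with
  the upward force frozen at \<open>2 * \<delta> / \<epsilon>\<close>, an upper bound until
  \<open>2 + \<delta>\<close>. Its equilibrium \<open>c\<close> is half of
  \<open>b * exp (- 3 * a)\<close> by the choice of \<open>\<delta>\<close>, so \<open>U\<close>
  remains below the layer.\<close>

lemma stays_low:
  assumes v: "trajectory v" and t: "1/8 \<le> t" "t \<le> 2 + \<delta>"
  shows "v t \<le> - 1"
proof -
  define c where "c = 2 * \<delta> / (a * \<epsilon>)"
  define U where "U t = c - b * exp (- a * (t - 1/8))" for t
  have c: "0 \<le> c" "c = b * exp (- 3 * a) / 2"
    using a_pos eps_pos by (auto simp: c_def \<delta>_def b_def)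
  have Uneg: "U t \<le> - 1" if "t \<le> 2 + \<delta>" for t
    using exp_ge_small[of "t - 1/8"] that delta b_exp c(2) by (simp add: U_def)
  have ac: "a * c = 2 * \<delta> / \<epsilon>" using a_pos by (simp add: c_def)
  have "v t \<le> U t"
  proof (rule derivative_barrier[where s="1/8" and u=v and U=U and T=t and u'="\<lambda>t. f t (v t)"
        and U'="\<lambda>t. a * (b * exp (- a * (t - 1/8)))" and L="M / \<epsilon>"])
    show "v (1/8) \<le> U (1/8)" using low_at_eighth[OF v] c by (simp add: U_def)
    fix s assume s: "s \<in> {1/8..t}"
    show "(v has_real_derivative f s (v s)) (at s within {1/8..t})"
      using s t delta by (intro trajectory_deriv[OF v]) auto
    show "(U has_real_derivative a * (b * exp (- a * (s - 1/8)))) (at s within {1/8..t})"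
      unfolding U_def by (auto intro!: derivative_eq_intros)
    assume less: "U s < v s"
    \<comment> \<open>The vector field is evaluated at the barrier, where \<psi> is known, and
      carried over to \<open>v s\<close> by \<open>f_diff_le\<close>.\<close>
    have "\<psi> (U s) = - 1" using Uneg[of s] s t by (intro psi_lo) auto
    moreover have "- (2 * \<delta>) \<le> half_sin s"
    proof (cases "s \<le> 2")
      case False
      then show ?thesis using half_sin_le[of "s - 2"] half_sin_shift[of "s - 2"] s t by auto
    qed (use half_sin_nonneg[of s] s delta in auto)
    ultimately have "f s (U s) \<le> - (a * U s) + 2 * \<delta> / \<epsilon>"
      using f_le[of "- (2 * \<delta>)" s "U s" "U s"] by (simp add: drift_minus_one)
    also have "\<dots> = a * (b * exp (- a * (s - 1/8)))"
      using ac by (simp add: U_def right_diff_distrib)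
    finally show "f s (v s) - a * (b * exp (- a * (s - 1/8))) \<le> M / \<epsilon> * (v s - U s)"
      using f_diff_le[of "U s" "v s" s] less by simp
  qed (use t in auto)
  then show ?thesis using Uneg[OF t(2)] by simp
qed

text \<open>Above the layer \<psi> is 1, so by \<open>drift\<close> the descent is no faster than
  pure damping, and \<open>b_exp\<close> covers three time units of that.\<close>

lemma stays_high:
  assumes v: "trajectory v" and s: "0 \<le> s" "b \<le> v s" and t: "s \<le> t" "t \<le> 4" "t \<le> s + 3"
    and drift: "\<And>r. s \<le> r \<Longrightarrow> r \<le> t \<Longrightarrow> drift r 1 \<le> 0"
  shows "1 \<le> v t"
proof -
  define U where "U t = b * exp (- a * (t - s))" for t
  have U: "1 \<le> U r" if "r \<le> t" for r
    using exp_ge_small[of "r - s"] that t b_exp by (simp add: U_def)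
  have "U t \<le> v t"
  proof (rule derivative_barrier[where s=s and u=U and U=v and T=t and U'="\<lambda>t. f t (v t)"
        and u'="\<lambda>t. - a * U t" and L="M / \<epsilon>"])
    show "U s \<le> v s" using s by (simp add: U_def)
    fix r assume r: "r \<in> {s..t}"
    show "(v has_real_derivative f r (v r)) (at r within {s..t})"
      using r s t by (intro trajectory_deriv[OF v]) auto
    show "(U has_real_derivative - a * U r) (at r within {s..t})"
      unfolding U_def by (auto intro!: derivative_eq_intros)
    assume less: "v r < U r"
    have "\<psi> (U r) = 1" using U[of r] r by (intro psi_hi) auto
    then have "- a * U r \<le> f r (U r)"
      using f_ge[of r "U r" 0 "U r"] drift[of r] r by simp
    then show "- a * U r - f r (v r) \<le> M / \<epsilon> * (U r - v r)"
      using f_diff_le[of "v r" "U r" r] less by simp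
  qed (use t in auto)
  then show ?thesis using U[of t] by simp
qed

lemma high_after_crossing: "trajectory v \<Longrightarrow> 17/8 \<le> t \<Longrightarrow> t \<le> 5/2 \<Longrightarrow> 1 \<le> v t"
  by (rule stays_high[of v "17/8"]) (auto intro: high_at_17_8 drift_nonpos)

lemma high_after_sliding: "trajectory v \<Longrightarrow> 7/2 \<le> t \<Longrightarrow> t \<le> 4 \<Longrightarrow> 1 \<le> v t"
  by (rule stays_high[of v "7/2"]) (auto intro: high_at_7_2 drift_nonpos)

section \<open>Sliding along the critical manifold\<close>

text \<open>Outside the band \<psi> misses the critical value by at least 1/4 and
  \<open>gain\<close> is at least 1/2, so the singular term beats the damping; time 1/12 suffices to
  enter from the ends of the trapping interval.\<close>

lemma in_layer:
  assumes v: "trajectory v" and T: "35/12 \<le> T" "T \<le> 19/6"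
  shows "ql \<le> v T" "v T \<le> qr"
proof -
  have ab: "a * ql \<ge> - a" "a * qr \<le> a"
    using a_pos ql qr mult_left_mono[of "-1" ql a] by auto
  have a: "a \<le> (1/16) / \<epsilon>" "0 < 1 / \<epsilon>" using a_le eps_pos by (auto simp: field_simps)
  have *: "1 / (16 * \<epsilon>) * (1/12) \<le> 1 / (16 * \<epsilon>) * (T - 17/6)"
    using T eps_pos by (intro mult_left_mono) auto
  have R: "R + 2 \<le> 1 / (16 * \<epsilon>) * (T - 17/6)"
  proof -
    have "1 / (32 * \<epsilon>) * (1/16) \<le> 1 / (16 * \<epsilon>) * (1/12)" using eps_pos by (simp add: field_simps)
    then show ?thesis using R_plus_b b_ge * by linarith
  qed
  have Rq: "R - qr \<le> 1 / (16 * \<epsilon>) * (T - 17/6)" "R + ql \<le> 1 / (16 * \<epsilon>) * (T - 17/6)"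
    using R ql qr ql_less_qr by linarith+
  have b: "\<bar>ql\<bar> \<le> R" "\<bar>qr\<bar> \<le> R" using b_ge b_le_R ql qr ql_less_qr by auto
  show "v T \<le> qr"
  proof (rule push_down[where s="17/6" and R=R and u=v and \<kappa>="1 / (16 * \<epsilon>)" and u'="\<lambda>t. f t (v t)"])
    fix t assume t: "t \<in> {17/6..T}" "qr < v t"
    have "1/2 * (1/4) \<le> gain t * (\<psi> (v t) - crit_val t)"
      using slide_bounds[of t] crit_val_bounds[of t] psi_mono[of qr "v t"] qr t T by (intro mult_mono) auto
    then have "f t (v t) \<le> - (a * qr) - (1/8) / \<epsilon>"
      using t T by (intro f_le) (auto simp: drift_slide)
    moreover have "- a \<le> a * qr" using qr ql ql_less_qr a_pos mult_left_mono[of "-1" qr a] by auto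
    ultimately show "f t (v t) \<le> - (1 / (16 * \<epsilon>))" using a by simp
  qed (use T Rq qr b eps_pos trajectory_bound[OF v, of "17/6"] in \<open>auto intro!: trajectory_deriv[OF v]\<close>)
  show "ql \<le> v T"
  proof (rule push_up[where s="17/6" and R=R and u=v and \<kappa>="1 / (16 * \<epsilon>)" and u'="\<lambda>t. f t (v t)"])
    fix t assume t: "t \<in> {17/6..T}" "v t < ql"
    have "1/2 * (1/2) \<le> gain t * (crit_val t - \<psi> (v t))"
      using slide_bounds[of t] crit_val_bounds[of t] psi_mono[of "v t" ql] ql t T by (intro mult_mono) auto
    then have "- (a * ql) - (- (1/4)) / \<epsilon> \<le> f t (v t)"
      using t T by (intro f_ge) (auto simp: drift_slide algebra_simps)
    moreover have "a * ql \<le> a" using qr ql_less_qr a_pos by auto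
    moreover have "2 * (1 / (16 * \<epsilon>)) \<le> 1 / (4 * \<epsilon>)" using eps_pos by (simp add: field_simps)
    moreover have "a \<le> 1 / (16 * \<epsilon>)" "- (a * ql) - (- (1/4)) / \<epsilon> = 1 / (4 * \<epsilon>) - a * ql"
      using a by simp_all
    ultimately show "1 / (16 * \<epsilon>) \<le> f t (v t)" by linarith
  qed (use T Rq ql qr ql_less_qr b eps_pos trajectory_bound[OF v, of "17/6"] in \<open>auto intro!: trajectory_deriv[OF v]\<close>)
qed

text \<open>The summand 32 is 8 for the motion of the critical value plus the speed 24, which
  removes a deviation of 2 within time 1/12.\<close>

definition K :: real where "K = 2 * (M * a + 32) / m"

lemma K_pos: "0 < K" unfolding K_def using M_pos a_pos m_pos by (intro divide_pos_pos mult_pos_pos add_pos_pos) auto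

text \<open>The deviation \<open>E\<close> relaxes at rate at least
  \<open>m / (2 * \<epsilon>)\<close>, while damping and the moving manifold disturb it by at most
  \<open>M * a + 8\<close>. Beyond \<open>K * \<epsilon>\<close> relaxation therefore wins by at
  least 24.\<close>

lemma near_critical_value:
  assumes v: "trajectory v" and T: "3 \<le> T" "T \<le> 19/6"
  shows "\<bar>\<psi> (v T) - crit_val T\<bar> \<le> K * \<epsilon>"
proof -
  define E where "E t = \<psi> (v t) - crit_val t" for t
  define E' where "E' t = \<psi>1 (v t) * f t (v t) - crit_val' t" for t
  have dE: "(E has_real_derivative E' t) (at t within {35/12..T})" if "t \<in> {35/12..T}" for t
    unfolding E_def E'_def
    using that T by (intro DERIV_diff DERIV_chain2[OF psi_deriv] trajectory_deriv[OF v] crit_val_deriv) auto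
  have layer: "ql \<le> v t" "v t \<le> qr" if "t \<in> {35/12..T}" for t
    using in_layer[OF v, of t] that T by auto
  have E0: "\<bar>E (35/12)\<bar> \<le> 2"
    using psi_range[of "v (35/12)"] crit_val_bounds[of "35/12"] unfolding E_def abs_le_iff by auto
  have Keps: "0 < K * \<epsilon>" using K_pos eps_pos by simp
  have decomp: "\<bar>E' t - \<psi>1 (v t) * (- gain t * E t / \<epsilon>)\<bar> \<le> M * a + 8"
    and rate: "m / 2 \<le> \<psi>1 (v t) * gain t" if t: "t \<in> {35/12..T}" for t
  proof -
    have 1: "\<bar>\<psi>1 (v t) * (a * v t)\<bar> \<le> M * (a * 1)"
      unfolding abs_mult using layer[OF t] ql qr psi1_le a_pos M_pos
      by (intro mult_mono) auto
    have 2: "\<bar>crit_val' t\<bar> \<le> 8" using t T by (intro crit_val'_abs_le) auto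
    have f: "f t (v t) = - a * v t - gain t * E t / \<epsilon>"
      using t T by (simp add: f_def drift_slide E_def)
    show "\<bar>E' t - \<psi>1 (v t) * (- gain t * E t / \<epsilon>)\<bar> \<le> M * a + 8"
    proof -
      have "E' t - \<psi>1 (v t) * (- gain t * E t / \<epsilon>) = - (\<psi>1 (v t) * (a * v t)) - crit_val' t"
        unfolding E'_def f by (simp add: algebra_simps)
      then show ?thesis using 1 2 by linarith
    qed
    have "m \<le> \<psi>1 (v t)" using layer[OF t] by (rule psi1_ge)
    then have "m * (1/2) \<le> \<psi>1 (v t) * gain t"
      using m_pos slide_bounds[of t] t T by (intro mult_mono) auto
    then show "m / 2 \<le> \<psi>1 (v t) * gain t" by simp
  qed
  have key: "M * a + 32 \<le> \<psi>1 (v t) * gain t * x / \<epsilon>" if "t \<in> {35/12..T}" "K * \<epsilon> < x" for t x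
  proof -
    have "m / 2 * (K * \<epsilon>) \<le> \<psi>1 (v t) * gain t * x"
      using rate[OF that(1)] that(2) m_pos Keps by (intro mult_mono) auto
    then have "m / 2 * (K * \<epsilon>) / \<epsilon> \<le> \<psi>1 (v t) * gain t * x / \<epsilon>"
      using eps_pos by (intro divide_right_mono) auto
    moreover have "m / 2 * (K * \<epsilon>) / \<epsilon> = M * a + 32"
      using m_pos eps_pos by (simp add: K_def)
    ultimately show ?thesis by simp
  qed
  have "E T \<le> K * \<epsilon>"
  proof (rule push_down[where s="35/12" and R="2 + K * \<epsilon>" and \<kappa>=24 and u=E and u'=E'])
    fix t assume "t \<in> {35/12..T}" "K * \<epsilon> < E t"
    then show "E' t \<le> - 24" using decomp[of t] key[of t "E t"] by (simp add: mult.assoc)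
  qed (use E0 Keps T dE in auto)
  moreover have "- (K * \<epsilon>) \<le> E T"
  proof (rule push_up[where s="35/12" and R="2 + K * \<epsilon>" and \<kappa>=24 and u=E and u'=E'])
    fix t assume "t \<in> {35/12..T}" "E t < - (K * \<epsilon>)"
    then show "24 \<le> E' t" using decomp[of t] key[of t "- E t"] by (simp add: mult.assoc)
  qed (use E0 Keps T dE in auto)
  ultimately show ?thesis by (simp add: E_def)
qed

lemma slides:
  assumes v: "trajectory v" and T: "3 \<le> T" "T \<le> 19/6"
  shows "\<bar>v T\<bar> < 1" "\<exists>u. (T, u) \<in> crit_manifold \<psi> \<and> \<bar>v T - u\<bar> \<le> K / m * \<epsilon>"
proof -
  have q: "ql \<le> v T" "v T \<le> qr" using in_layer[OF v, of T] T by auto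
  then show "\<bar>v T\<bar> < 1" using ql qr by auto
  have y: "0 \<le> crit_val T" "crit_val T \<le> 1/4" using crit_val_bounds[of T] T by auto
  obtain u where u: "ql \<le> u" "u \<le> qr" "\<psi> u = crit_val T"
    using IVT'[of \<psi> ql "crit_val T" qr] ql qr y ql_less_qr psi_cont by auto
  have "(T, u) \<in> crit_manifold \<psi>"
    \<comment> \<open>The index 1 selects the branch over \<open>(8/3, 10/3)\<close>, which is
      attracting.\<close>
    unfolding crit_manifold_def using u ql qr T by (auto simp: crit_val_def intro!: exI[of _ 1])
  moreover have "m * \<bar>v T - u\<bar> \<le> K * \<epsilon>"
    using psi_ge_linear[OF q u(1,2)] near_critical_value[OF v T] u by simp
  ultimately show "\<exists>u. (T, u) \<in> crit_manifold \<psi> \<and> \<bar>v T - u\<bar> \<le> K / m * \<epsilon>"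
    using m_pos by (intro exI[of _ u]) (auto simp: field_simps)
qed

section \<open>Contraction of the return map\<close>

lemma f_diff: "(x - y) * (f t x - f t y) =
    - a * (x - y)\<^sup>2 - gain t * ((\<psi> x - \<psi> y) * (x - y)) / \<epsilon>"
proof -
  have "f t x - f t y = - a * (x - y) - (drift t (\<psi> x) - drift t (\<psi> y)) / \<epsilon>"
    by (simp add: f_def diff_divide_distrib algebra_simps)
  moreover have "d * (- a * d - g * p / \<epsilon>) = - a * d\<^sup>2 - g * (p * d) / \<epsilon>" for d g p
    by (simp add: power2_eq_square algebra_simps)
  ultimately show ?thesis by (simp only: drift_diff)
qed

lemma psi_diff_nonneg: "0 \<le> (\<psi> x - \<psi> y) * (x - y)"
  using psi_mono[of x y] psi_mono[of y x]
  by (cases "x \<le> y") (auto intro: mult_nonpos_nonpos)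

lemma diff_bound:
  assumes u: "solves_on a \<epsilon> \<psi> I u" and w: "solves_on a \<epsilon> \<psi> I w" and "s \<le> T" and I: "{s..T} \<subseteq> I"
    and le: "\<And>t. t \<in> {s..T} \<Longrightarrow> (u t - w t) * (f t (u t) - f t (w t)) \<le> \<gamma> * (u t - w t)\<^sup>2"
  shows "\<bar>u T - w T\<bar> \<le> exp (\<gamma> * (T - s)) * \<bar>u s - w s\<bar>"
  by (rule gronwall_abs[where d'="\<lambda>t. f t (u t) - f t (w t)"])
    (use assms in \<open>auto intro!: DERIV_diff solves_on_deriv[OF u I] solves_on_deriv[OF w I]\<close>)

lemma diff_bound_crude:
  assumes "solves_on a \<epsilon> \<psi> I u" "solves_on a \<epsilon> \<psi> I w" "s \<le> T" "{s..T} \<subseteq> I"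
  shows "\<bar>u T - w T\<bar> \<le> exp (M / \<epsilon> * (T - s)) * \<bar>u s - w s\<bar>"
proof (rule diff_bound[OF assms])
  fix t
  have "(x - y) * (f t x - f t y) \<le> M / \<epsilon> * (x - y)\<^sup>2" if "y \<le> x" for x y
    using mult_left_mono[OF f_diff_le[OF that, of t], of "x - y"] that
    by (simp add: power2_eq_square mult_ac)
  from this[of "u t" "w t"] this[of "w t" "u t"]
  show "(u t - w t) * (f t (u t) - f t (w t)) \<le> M / \<epsilon> * (u t - w t)\<^sup>2"
    by (cases "w t \<le> u t") (auto simp: power2_commute algebra_simps)
qed

lemma solution_unique:
  assumes "solves_on a \<epsilon> \<psi> I u" "solves_on a \<epsilon> \<psi> I w" "s \<le> T" "{s..T} \<subseteq> I" "u s = w s"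
  shows "u T = w T"
  using diff_bound_crude[OF assms(1-4)] assms(5) by simp

text \<open>In \<open>f_diff\<close> the contribution of \<psi> has a favourable sign when
  \<open>gain\<close> is non-negative and vanishes when both values of \<psi> agree.\<close>

lemma trajectory_nonexpanding:
  assumes u: "trajectory u" and w: "trajectory w" and "0 \<le> s" "s \<le> T" "T \<le> 4"
    and *: "\<And>t. s \<le> t \<Longrightarrow> t \<le> T \<Longrightarrow> 0 \<le> gain t \<or> \<psi> (u t) = \<psi> (w t)"
  shows "\<bar>u T - w T\<bar> \<le> \<bar>u s - w s\<bar>"
proof -
  have "\<bar>u T - w T\<bar> \<le> exp (0 * (T - s)) * \<bar>u s - w s\<bar>"
  proof (rule diff_bound)
    fix t assume t: "t \<in> {s..T}"
    have "0 \<le> gain t * ((\<psi> (u t) - \<psi> (w t)) * (u t - w t)) / \<epsilon>"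
      using *[of t] t psi_diff_nonneg eps_pos by auto
    then show "(u t - w t) * (f t (u t) - f t (w t)) \<le> 0 * (u t - w t)\<^sup>2"
      using mult_nonneg_nonneg[OF less_imp_le[OF a_pos] zero_le_power2[of "u t - w t"]]
      unfolding f_diff by linarith
  qed (use assms in \<open>auto simp: trajectory_def\<close>)
  then show ?thesis by simp
qed

text \<open>The rate \<open>m / (2 * \<epsilon>)\<close>, from the slope \<open>m\<close> and a
  \<open>gain\<close> of at least 1/2, acts during time 1/4.\<close>

lemma sliding_contracts:
  assumes u: "trajectory u" and w: "trajectory w"
  shows "\<bar>u (19/6) - w (19/6)\<bar> \<le> exp (- (m / 8) / \<epsilon>) * \<bar>u (35/12) - w (35/12)\<bar>"
proof -
  have "\<bar>u (19/6) - w (19/6)\<bar> \<le> exp (- (m / (2 * \<epsilon>)) * (19/6 - 35/12)) * \<bar>u (35/12) - w (35/12)\<bar>"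
  proof (rule diff_bound)
    fix t :: real assume t: "t \<in> {35/12..19/6}"
    have "m * \<bar>u t - w t\<bar> \<le> \<bar>\<psi> (u t) - \<psi> (w t)\<bar>"
      using in_layer[OF u, of t] in_layer[OF w, of t] t by (intro psi_ge_linear) auto
    then have "m * \<bar>u t - w t\<bar> * \<bar>u t - w t\<bar> \<le> \<bar>\<psi> (u t) - \<psi> (w t)\<bar> * \<bar>u t - w t\<bar>"
      by (intro mult_right_mono) auto
    also have "\<dots> = (\<psi> (u t) - \<psi> (w t)) * (u t - w t)"
      using psi_diff_nonneg[of "u t" "w t"] by (simp only: abs_mult[symmetric] abs_of_nonneg)
    finally have slope: "m * (u t - w t)\<^sup>2 \<le> (\<psi> (u t) - \<psi> (w t)) * (u t - w t)"
      by (simp add: power2_eq_square mult.assoc)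
    have "1/2 * (m * (u t - w t)\<^sup>2) \<le> gain t * ((\<psi> (u t) - \<psi> (w t)) * (u t - w t))"
      by (rule mult_mono) (use slope slide_bounds[of t] t m_pos in auto)
    then have "1/2 * (m * (u t - w t)\<^sup>2) / \<epsilon> \<le> gain t * ((\<psi> (u t) - \<psi> (w t)) * (u t - w t)) / \<epsilon>"
      using eps_pos by (intro divide_right_mono) auto
    moreover have "0 \<le> a * (u t - w t)\<^sup>2" using a_pos by simp
    moreover have "1/2 * (m * (u t - w t)\<^sup>2) / \<epsilon> = m / (2 * \<epsilon>) * (u t - w t)\<^sup>2" by simp
    ultimately show "(u t - w t) * (f t (u t) - f t (w t)) \<le> - (m / (2 * \<epsilon>)) * (u t - w t)\<^sup>2"
      unfolding f_diff by linarith
  qed (use assms in \<open>auto simp: trajectory_def\<close>)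
  then show ?thesis by (simp add: field_simps)
qed

lemma speed_le:
  assumes v: "trajectory v" and "0 \<le> t" "t \<le> 4"
  shows "\<bar>f t (v t)\<bar> \<le> 7 / \<epsilon>"
proof -
  have v: "v t \<le> R" "- R \<le> v t" using trajectory_bound[OF assms] by auto
  have "f t (v t) \<le> - (a * (- R)) - (- 3) / \<epsilon>" by (rule f_le) (use drift_psi_abs_le v in auto)
  moreover have "- (a * R) - 3 / \<epsilon> \<le> f t (v t)" by (rule f_ge) (use drift_psi_abs_le v in auto)
  ultimately show ?thesis using a_times_R by (simp add: abs_le_iff flip: add_divide_distrib)
qed

text \<open>The layer is crossed upwards while the linearisation is expanding. As \<open>f\<close> increases in time
  there, a time shift of the lower trajectory is a barrier for the upper one; this converts the initial distance
  into a time delay and back at the cost of a factor independent of \<open>\<epsilon>\<close>.\<close>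

lemma crossing_ordered:
  assumes u: "trajectory u" and w: "trajectory w" and le: "w (2 + \<delta>) \<le> u (2 + \<delta>)"
  shows "\<bar>u (17/8) - w (17/8)\<bar> \<le> 7 / \<delta> * \<bar>u (2 + \<delta>) - w (2 + \<delta>)\<bar>"
proof -
  define s where "s = 2 + \<delta>"
  have s: "2 < s" "s < 17/8" using delta by (auto simp: s_def)
  have us: "u s \<le> - 1" using stays_low[OF u, of s] s by (simp add: s_def)
  have cw: "continuous_on {s..17/8} w"
    using trajectory_deriv[OF w, of s "17/8"] s by (intro DERIV_continuous_on) auto
  \<comment> \<open>Its minimum \<open>r\<close> is the first time at which the lower trajectory
    reaches the level \<open>u s\<close>; the time shift is \<open>h = r - s\<close>.\<close>
  define A where "A = {t \<in> {s..17/8}. w t \<in> {u s..}}"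
  have "closed A"
    using continuous_closed_preimage[OF cw, of "{u s..}"] by (simp add: A_def vimage_def Int_def)
  moreover have "bounded A"
    unfolding A_def by (rule bounded_subset[of "{s..17/8}"]) auto
  ultimately have "compact A" by (simp add: compact_eq_bounded_closed)
  moreover have "17/8 \<in> A"
    using high_at_17_8[OF w] b_ge us s by (simp add: A_def)
  ultimately obtain r where r: "r \<in> A" "\<And>t. t \<in> A \<Longrightarrow> r \<le> t"
    using compact_attains_inf[of A] by blast
  have sr: "s \<le> r" "r \<le> 17/8" "u s \<le> w r" using r(1) by (auto simp: A_def)
  have before: "w t < u s" if "s \<le> t" "t < r" for t
    using r(2)[of t] that sr by (force simp: A_def)
  define h where "h = r - s"
  have h: "0 \<le> h" "h \<le> 1/8" using sr s by (auto simp: h_def)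
  have "w r = u s"
  proof (rule ccontr)
    assume "w r \<noteq> u s"
    then have "u s < w r" using sr by simp
    moreover from this le have "s < r" using sr by (cases "s = r") (auto simp: s_def)
    moreover have "continuous_on {s..r} w" using sr by (auto intro: continuous_on_subset[OF cw])
    ultimately obtain x where "s \<le> x" "x \<le> r" "w x = u s"
      using IVT'[of w s "u s" r] le by (auto simp: s_def)
    with before[of x] \<open>u s < w r\<close> show False by (cases "x = r") auto
  qed
  \<comment> \<open>Until \<open>r\<close> the lower trajectory is below the layer and, past
    \<open>2 + \<delta>\<close>, rises at speed at least \<open>\<delta> / \<epsilon>\<close>.
    Starting at \<open>s\<close> rather than at 2 is what bounds this speed from below.\<close>
  have delay: "h * (\<delta> / \<epsilon>) \<le> u s - w s"
  proof (cases "s = r")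
    case True
    then show ?thesis using le by (simp add: h_def s_def)
  next
    case False
    obtain \<xi> where \<xi>: "s < \<xi>" "\<xi> < r" "w r - w s = (r - s) * f \<xi> (w \<xi>)"
      by (rule diff_eq_deriv_within[of s r w "\<lambda>t. f t (w t)"])
        (use False sr s in \<open>auto intro!: trajectory_deriv[OF w]\<close>)
    have w1: "w \<xi> \<le> - 1" using before[of \<xi>] \<xi> us by simp
    have "\<delta> \<le> half_sin (\<xi> - 2)" using half_sin_ge[of "\<xi> - 2"] \<xi> sr s by (auto simp: s_def)
    then have "drift \<xi> (\<psi> (w \<xi>)) \<le> - \<delta>"
      using psi_lo[OF w1] half_sin_shift[of "\<xi> - 2"] by (simp add: drift_minus_one)
    then have "- (a * 0) - (- \<delta>) / \<epsilon> \<le> f \<xi> (w \<xi>)" using w1 by (intro f_ge) auto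
    then have "h * (\<delta> / \<epsilon>) \<le> h * f \<xi> (w \<xi>)" using h by (intro mult_left_mono) auto
    then show ?thesis using \<xi> \<open>w r = u s\<close> by (simp add: h_def)
  qed
  \<comment> \<open>Shifted times reach at most \<open>9/4\<close>, inside the range of
    \<open>drift_antimono\<close>.\<close>
  have "u (17/8) \<le> w (17/8 + h)"
  proof (rule derivative_barrier[where s=s and u=u and U="\<lambda>t. w (t + h)" and T="17/8" and L="M / \<epsilon>"
        and u'="\<lambda>t. f t (u t)" and U'="\<lambda>t. f (t + h) (w (t + h))"])
    show "u s \<le> w (s + h)" using \<open>w r = u s\<close> by (simp add: h_def)
    fix t :: real assume t: "t \<in> {s..17/8}"
    show "(u has_real_derivative f t (u t)) (at t within {s..17/8})"
      using t s by (intro trajectory_deriv[OF u]) auto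
    have "(w has_real_derivative f (t + h) (w (t + h))) (at (t + h) within {s + h..17/8 + h})"
      using t s h by (intro trajectory_deriv[OF w]) auto
    moreover have "(\<lambda>t. t + h) ` {s..17/8} = {s + h..17/8 + h}" by simp
    ultimately have "(w \<circ> (\<lambda>t. t + h) has_real_derivative f (t + h) (w (t + h)) * 1) (at t within {s..17/8})"
      by (intro DERIV_image_chain) (auto intro!: derivative_eq_intros)
    then show "((\<lambda>t. w (t + h)) has_real_derivative f (t + h) (w (t + h))) (at t within {s..17/8})"
      by (simp add: o_def)
    assume "w (t + h) < u t"
    then have "f t (u t) - f t (w (t + h)) \<le> M / \<epsilon> * (u t - w (t + h))"
      by (intro f_diff_le) auto
    moreover have "f t (w (t + h)) \<le> f (t + h) (w (t + h))"
      unfolding f_def using eps_pos psi_range t h s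
      by (intro diff_left_mono divide_right_mono drift_antimono) auto
    ultimately show "f t (u t) - f (t + h) (w (t + h)) \<le> M / \<epsilon> * (u t - w (t + h))" by simp
  qed (use s in auto)
  \<comment> \<open>The delay becomes a distance again through the speed bound
    \<open>7 / \<epsilon>\<close>; combined with \<open>delay\<close>, the powers of
    \<open>\<epsilon>\<close> cancel.\<close>
  moreover have "w (17/8 + h) - w (17/8) \<le> h * (7 / \<epsilon>)"
  proof (cases "h = 0")
    case False
    then have h': "0 < h" using h by simp
    obtain \<xi> where \<xi>: "17/8 < \<xi>" "\<xi> < 17/8 + h" 
      "w (17/8 + h) - w (17/8) = (17/8 + h - 17/8) * f \<xi> (w \<xi>)"
      by (rule diff_eq_deriv_within[of "17/8" "17/8 + h" w "\<lambda>t. f t (w t)"])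
        (use h h' in \<open>auto intro!: trajectory_deriv[OF w]\<close>)
    have "h * f \<xi> (w \<xi>) \<le> h * (7 / \<epsilon>)"
      using speed_le[OF w, of \<xi>] \<xi> h by (intro mult_left_mono) auto
    then show ?thesis using \<xi> by simp
  qed simp
  moreover have "h * (7 / \<epsilon>) \<le> 7 / \<delta> * (u s - w s)"
    using delay delta eps_pos by (simp add: field_simps)
  moreover have "w (17/8) \<le> u (17/8)"
  proof (rule derivative_barrier[where s=s and u=w and U=u and T="17/8" and L="M / \<epsilon>"
        and u'="\<lambda>t. f t (w t)" and U'="\<lambda>t. f t (u t)"])
    fix t :: real assume "t \<in> {s..17/8}"
    then show "(w has_real_derivative f t (w t)) (at t within {s..17/8})"
      "(u has_real_derivative f t (u t)) (at t within {s..17/8})"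
      using s by (auto intro!: trajectory_deriv u w)
    show "f t (w t) - f t (u t) \<le> M / \<epsilon> * (w t - u t)" if "u t < w t"
      using that by (intro f_diff_le) auto
  qed (use s le in \<open>auto simp: s_def\<close>)
  ultimately show ?thesis using le by (simp add: s_def)
qed

lemma crossing_bounded:
  assumes "trajectory u" "trajectory w"
  shows "\<bar>u (17/8) - w (17/8)\<bar> \<le> 7 / \<delta> * \<bar>u (2 + \<delta>) - w (2 + \<delta>)\<bar>"
  using crossing_ordered[OF assms] crossing_ordered[OF assms(2,1)]
  by (cases "w (2 + \<delta>) \<le> u (2 + \<delta>)") (auto simp: abs_minus_commute)

text \<open>The period splits at \<open>2 + \<delta>\<close>, \<open>17/8\<close>,
  \<open>35/12\<close> and \<open>19/6\<close>. The first, third and last pieces do not expand, the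
  second costs \<open>7 / \<delta>\<close>, and the fourth, the sliding phase, supplies the
  exponential factor.\<close>

lemma return_contracts:
  assumes u: "trajectory u" and w: "trajectory w"
  shows "\<bar>u 4 - w 4\<bar> \<le> 7 / \<delta> * exp (- (m / 8) / \<epsilon>) * \<bar>u 0 - w 0\<bar>"
proof -
  note ne = trajectory_nonexpanding[OF u w]
  have d: "7 / \<delta> \<ge> 0" using delta by simp
  have 1: "\<bar>u 4 - w 4\<bar> \<le> \<bar>u (19/6) - w (19/6)\<bar>"
  proof (rule ne)
    fix t :: real assume t: "19/6 \<le> t" "t \<le> 4"
    show "0 \<le> gain t \<or> \<psi> (u t) = \<psi> (w t)"
      using gain_nonneg[of t] high_after_sliding[OF u, of t] high_after_sliding[OF w, of t] t
      by (cases "t \<le> 7/2") (auto simp: psi_hi)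
  qed auto
  have 2: "\<bar>u (35/12) - w (35/12)\<bar> \<le> \<bar>u (17/8) - w (17/8)\<bar>"
  proof (rule ne)
    fix t :: real assume t: "17/8 \<le> t" "t \<le> 35/12"
    show "0 \<le> gain t \<or> \<psi> (u t) = \<psi> (w t)"
      using gain_nonneg[of t] high_after_crossing[OF u, of t] high_after_crossing[OF w, of t] t
      by (cases "t \<le> 5/2") (auto simp: psi_hi)
  qed auto
  have 3: "\<bar>u (2 + \<delta>) - w (2 + \<delta>)\<bar> \<le> \<bar>u 0 - w 0\<bar>"
  proof (rule ne)
    fix t :: real assume t: "0 \<le> t" "t \<le> 2 + \<delta>"
    show "0 \<le> gain t \<or> \<psi> (u t) = \<psi> (w t)"
      using gain_nonneg[of t] stays_low[OF u, of t] stays_low[OF w, of t] t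
      by (cases "t < 1/8") (auto simp: psi_lo)
  qed (use delta in auto)
  have "\<bar>u (35/12) - w (35/12)\<bar> \<le> 7 / \<delta> * \<bar>u 0 - w 0\<bar>"
    using 2 crossing_bounded[OF u w] mult_left_mono[OF 3 d] by linarith
  then have "exp (- (m / 8) / \<epsilon>) * \<bar>u (35/12) - w (35/12)\<bar> \<le> exp (- (m / 8) / \<epsilon>) * (7 / \<delta> * \<bar>u 0 - w 0\<bar>)"
    by (intro mult_left_mono) auto
  with 1 sliding_contracts[OF u w] show ?thesis by (simp add: mult_ac)
qed

section \<open>The periodic solution\<close>

lemma f_period: "f (t + 4) x = f t x"
  by (simp add: f_def drift_period)

lemma solution_exists:
  obtains v where "solves_on a \<epsilon> \<psi> {0..} v" "v 0 = x0"
proof -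
  have "\<exists>v. v 0 = x0 \<and> (\<forall>t\<ge>0. (v has_real_derivative f t (v t)) (at t within {0..}))"
  proof (rule global_solution[of f "a + M / \<epsilon>" "3 / \<epsilon>" x0])
    fix g :: "real \<Rightarrow> real" assume g: "continuous_on {0..} g"
    show "continuous_on {0..} (\<lambda>t. f t (g t))"
      unfolding f_def drift_def half_sin_def
      by (intro continuous_intros g continuous_on_compose2[OF psi_cont[of UNIV] g]) (use eps_pos in auto)
  next
    fix t x y :: real
    have "\<bar>(drift t (\<psi> x) - drift t (\<psi> y)) / \<epsilon>\<bar> \<le> M * \<bar>x - y\<bar> / \<epsilon>"
      using drift_lip[of t x y] eps_pos by (simp add: abs_divide divide_right_mono)
    moreover have "\<bar>a * (x - y)\<bar> = a * \<bar>x - y\<bar>" using a_pos by (simp add: abs_mult)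
    moreover have "f t x - f t y = - (a * (x - y)) - (drift t (\<psi> x) - drift t (\<psi> y)) / \<epsilon>"
      by (simp add: f_def diff_divide_distrib algebra_simps)
    ultimately have "\<bar>f t x - f t y\<bar> \<le> a * \<bar>x - y\<bar> + M * \<bar>x - y\<bar> / \<epsilon>" by linarith
    then show "\<bar>f t x - f t y\<bar> \<le> (a + M / \<epsilon>) * \<bar>x - y\<bar>" by (simp add: distrib_right)
  next
    fix t :: real
    have "\<bar>drift t (\<psi> 0)\<bar> / \<epsilon> \<le> 3 / \<epsilon>"
      using drift_psi_abs_le[of t 0] eps_pos by (intro divide_right_mono) auto
    then show "\<bar>f t 0\<bar> \<le> 3 / \<epsilon>" using eps_pos by (simp add: f_def)
  qed (use a_pos M_pos eps_pos in auto)
  then show ?thesis using that by (auto simp: solves_on_iff)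
qed

lemma solves_on_shift:
  assumes "solves_on a \<epsilon> \<psi> {0..} v"
  shows "solves_on a \<epsilon> \<psi> {0..} (\<lambda>t. v (t + 4))"
  unfolding solves_on_iff
proof
  fix t :: real assume t: "t \<in> {0..}"
  have "x \<in> (\<lambda>t. t + 4) ` {0..}" if "4 \<le> x" for x :: real
    using that by (intro image_eqI[of _ _ "x - 4"]) auto
  then have "(\<lambda>t. t + 4) ` {0..} = {4::real..}" by auto
  then have "(v has_real_derivative f (t + 4) (v (t + 4))) (at (t + 4) within (\<lambda>t. t + 4) ` {0..})"
    using t by (intro solves_on_deriv[OF assms]) auto
  then have "(v \<circ> (\<lambda>t. t + 4) has_real_derivative f (t + 4) (v (t + 4)) * 1) (at t within {0..})"
    by (intro DERIV_image_chain) (auto intro!: derivative_eq_intros)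
  then show "((\<lambda>t. v (t + 4)) has_real_derivative f t (v (t + 4))) (at t within {0..})"
    by (simp add: o_def f_period)
qed

lemma solves_on_restrict: "solves_on a \<epsilon> \<psi> {0..} v \<Longrightarrow> solves_on a \<epsilon> \<psi> {0..4} v"
  unfolding solves_on_iff[of "{0..4}"] using solves_on_deriv[of "{0..}" v "{0..4}"] by auto

lemma trajectoryI: "solves_on a \<epsilon> \<psi> {0..} v \<Longrightarrow> \<bar>v 0\<bar> \<le> R \<Longrightarrow> trajectory v"
  by (simp add: trajectory_def solves_on_restrict)

lemma trajectory_from:
  assumes "\<bar>x0\<bar> \<le> R"
  obtains v where "trajectory v" "solves_on a \<epsilon> \<psi> {0..} v" "v 0 = x0"
proof -
  obtain v where v: "solves_on a \<epsilon> \<psi> {0..} v" "v 0 = x0" using solution_exists .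
  then show ?thesis using that trajectoryI assms by simp
qed

lemma poincare_eq:
  assumes v: "trajectory v"
  shows "poincare a \<epsilon> \<psi> (v 0) = v 4"
  unfolding poincare_def
proof (rule the_equality)
  show "\<exists>w. solves_on a \<epsilon> \<psi> {0..4} w \<and> w 0 = v 0 \<and> w 4 = v 4"
    using v by (auto simp: trajectory_def)
  fix x assume "\<exists>w. solves_on a \<epsilon> \<psi> {0..4} w \<and> w 0 = v 0 \<and> w 4 = x"
  then obtain w where "solves_on a \<epsilon> \<psi> {0..4} w" "w 0 = v 0" "w 4 = x" by blast
  then show "x = v 4"
    using solution_unique[of "{0..4}" w v 0 4] v by (auto simp: trajectory_def)
qed

lemma poincare_lipschitz:
  assumes "\<bar>x\<bar> \<le> R" "\<bar>y\<bar> \<le> R"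
  shows "\<bar>poincare a \<epsilon> \<psi> x - poincare a \<epsilon> \<psi> y\<bar> \<le> 7 / \<delta> * exp (- (m / 8) / \<epsilon>) * \<bar>x - y\<bar>"
proof -
  obtain u where u: "trajectory u" "solves_on a \<epsilon> \<psi> {0..} u" "u 0 = x"
    using trajectory_from[OF assms(1)] .
  obtain w where w: "trajectory w" "solves_on a \<epsilon> \<psi> {0..} w" "w 0 = y"
    using trajectory_from[OF assms(2)] .
  show ?thesis
    using return_contracts[OF u(1) w(1)] poincare_eq[OF u(1)] poincare_eq[OF w(1)] u(3) w(3) by simp
qed

lemma poincare_abs_le:
  assumes "\<bar>x\<bar> \<le> R"
  shows "\<bar>poincare a \<epsilon> \<psi> x\<bar> \<le> 7/8 * R"
proof -
  obtain u where u: "trajectory u" "solves_on a \<epsilon> \<psi> {0..} u" "u 0 = x"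
    using trajectory_from[OF assms] .
  show ?thesis using trajectory_end_bound[OF u(1)] poincare_eq[OF u(1)] u(3) by simp
qed

end

text \<open>The exponential gain from sliding must outweigh the expansion of the crossing.\<close>

locale contracting_flow = flow +
  assumes contracting: "7 / \<delta> * exp (- (m / 8) / \<epsilon>) \<le> 1/2"
begin

text \<open>A fixed point of the return map extends to a periodic solution, because the shift by 4
  solves the same equation with the same initial value.\<close>

lemma periodic_solution:
  obtains vs where "solves_on a \<epsilon> \<psi> {0..} vs" "\<And>t. 0 \<le> t \<Longrightarrow> vs (t + 4) = vs t" "\<bar>vs 0\<bar> \<le> 7/8 * R"
proof -
  have "\<exists>!x. x \<in> {- R..R} \<and> poincare a \<epsilon> \<psi> x = x"
  proof (rule Banach_fix[where c="1/2"])
    show "poincare a \<epsilon> \<psi> ` {- R..R} \<subseteq> {- R..R}"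
      using poincare_abs_le R_pos by (force simp: abs_le_iff)
    fix x y assume "x \<in> {- R..R}" "y \<in> {- R..R}"
    then have "\<bar>poincare a \<epsilon> \<psi> x - poincare a \<epsilon> \<psi> y\<bar> \<le> 7 / \<delta> * exp (- (m / 8) / \<epsilon>) * \<bar>x - y\<bar>"
      by (intro poincare_lipschitz) auto
    also have "\<dots> \<le> 1/2 * \<bar>x - y\<bar>"
      using contracting by (intro mult_right_mono) auto
    finally show "dist (poincare a \<epsilon> \<psi> x) (poincare a \<epsilon> \<psi> y) \<le> 1/2 * dist x y"
      by (simp add: dist_real_def)
  qed (use R_pos in \<open>auto simp: complete_eq_closed\<close>)
  then obtain x where "x \<in> {- R..R}" and "poincare a \<epsilon> \<psi> x = x" by blast
  then have x: "\<bar>x\<bar> \<le> R" "poincare a \<epsilon> \<psi> x = x" by auto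
  obtain vs where vs: "trajectory vs" "solves_on a \<epsilon> \<psi> {0..} vs" "vs 0 = x"
    using trajectory_from[OF x(1)] .
  have "vs 4 = vs 0" using poincare_eq[OF vs(1)] vs(3) x(2) by simp
  then have "vs (t + 4) = vs t" if "0 \<le> t" for t
    using solution_unique[OF solves_on_shift[OF vs(2)] vs(2), of 0 t] that by auto
  moreover have "\<bar>vs 0\<bar> \<le> 7/8 * R" using poincare_abs_le[OF x(1)] x(2) vs(3) by simp
  ultimately show ?thesis using that vs(2) by blast
qed

section \<open>Asymptotic stability\<close>

text \<open>The induction ranges over all pairs, since its step passes to the solutions shifted by
  one period.\<close>

lemma geometric_decay:
  assumes "solves_on a \<epsilon> \<psi> {0..} u" "solves_on a \<epsilon> \<psi> {0..} w" "\<bar>u 0\<bar> \<le> R" "\<bar>w 0\<bar> \<le> R"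
  shows "\<bar>u (4 * real n) - w (4 * real n)\<bar> \<le> (1/2) ^ n * \<bar>u 0 - w 0\<bar>"
  using assms
proof (induction n arbitrary: u w)
  case (Suc n)
  have tr: "trajectory u" "trajectory w" using Suc.prems trajectoryI by auto
  have "\<bar>u (0 + 4)\<bar> \<le> R" "\<bar>w (0 + 4)\<bar> \<le> R"
    using tr[THEN trajectory_bound, of 4] by auto
  then have "\<bar>u (4 * real n + 4) - w (4 * real n + 4)\<bar> \<le> (1/2) ^ n * \<bar>u (0 + 4) - w (0 + 4)\<bar>"
    using Suc.prems by (intro Suc.IH solves_on_shift) auto
  also have "\<dots> \<le> (1/2) ^ n * (1/2 * \<bar>u 0 - w 0\<bar>)"
    using return_contracts[OF tr] mult_right_mono[OF contracting, of "\<bar>u 0 - w 0\<bar>"]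
    by (intro mult_left_mono) auto
  finally show ?case by (simp add: add.commute)
qed simp

text \<open>Between multiples of the period the crude exponential bound applies, over a time of at
  most 4.\<close>

lemma decay:
  assumes u: "solves_on a \<epsilon> \<psi> {0..} u" "\<bar>u 0\<bar> \<le> R" and w: "solves_on a \<epsilon> \<psi> {0..} w" "\<bar>w 0\<bar> \<le> R"
    and t: "0 \<le> t"
  shows "\<bar>u t - w t\<bar> \<le> exp (4 * M / \<epsilon>) * ((1/2) ^ nat \<lfloor>t / 4\<rfloor> * \<bar>u 0 - w 0\<bar>)"
proof -
  define n where "n = nat \<lfloor>t / 4\<rfloor>"
  have n: "4 * real n \<le> t" "t - 4 * real n \<le> 4" using t unfolding n_def by linarith+
  have "M / \<epsilon> * (t - 4 * real n) \<le> M / \<epsilon> * 4"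
    using n M_pos eps_pos by (intro mult_left_mono) auto
  then have e: "exp (M / \<epsilon> * (t - 4 * real n)) \<le> exp (4 * M / \<epsilon>)" by (simp add: mult.commute)
  have "\<bar>u t - w t\<bar> \<le> exp (M / \<epsilon> * (t - 4 * real n)) * \<bar>u (4 * real n) - w (4 * real n)\<bar>"
    using n by (intro diff_bound_crude[OF u(1) w(1)]) auto
  also have "\<dots> \<le> exp (4 * M / \<epsilon>) * ((1/2) ^ n * \<bar>u 0 - w 0\<bar>)"
    by (intro mult_mono e geometric_decay u w) auto
  finally show ?thesis by (simp add: n_def)
qed

lemma stable:
  assumes vs: "solves_on a \<epsilon> \<psi> {0..} vs" "\<bar>vs 0\<bar> \<le> 7/8 * R"
  shows "loc_asym_stable a \<epsilon> \<psi> vs"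
proof -
  define C where "C = exp (4 * M / \<epsilon>)"
  have C: "0 < C" by (simp add: C_def)
  have R: "\<bar>vs 0\<bar> \<le> R" "\<And>x. \<bar>x - vs 0\<bar> < R / 8 \<Longrightarrow> \<bar>x\<bar> \<le> R" using vs(2) by linarith+
  have dec: "\<bar>w t - vs t\<bar> \<le> C * ((1/2) ^ nat \<lfloor>t / 4\<rfloor> * \<bar>w 0 - vs 0\<bar>)"
    if "solves_on a \<epsilon> \<psi> {0..} w" "\<bar>w 0 - vs 0\<bar> < R / 8" "0 \<le> t" for w t
    unfolding C_def using that R by (intro decay vs) auto
  show ?thesis
    unfolding loc_asym_stable_def
  proof (intro conjI allI impI)
    fix \<eta> :: real assume \<eta>: "\<eta> > 0"
    show "\<exists>\<delta>>0. \<forall>w. solves_on a \<epsilon> \<psi> {0..} w \<and> \<bar>w 0 - vs 0\<bar> < \<delta> \<longrightarrow> (\<forall>t\<ge>0. \<bar>w t - vs t\<bar> < \<eta>)"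
    proof (intro exI[of _ "min (R / 8) (\<eta> / C)"] conjI allI impI)
      fix w and t :: real
      assume w: "solves_on a \<epsilon> \<psi> {0..} w \<and> \<bar>w 0 - vs 0\<bar> < min (R / 8) (\<eta> / C)" and t: "0 \<le> t"
      have "\<bar>w t - vs t\<bar> \<le> C * ((1/2) ^ nat \<lfloor>t / 4\<rfloor> * \<bar>w 0 - vs 0\<bar>)"
        using w t by (intro dec) auto
      also have "\<dots> \<le> C * (1 * \<bar>w 0 - vs 0\<bar>)"
        using C by (intro mult_left_mono mult_right_mono power_le_one) auto
      also have "\<dots> < \<eta>" using w C by (simp add: field_simps)
      finally show "\<bar>w t - vs t\<bar> < \<eta>" .
    qed (use \<eta> C R_pos in auto)
  next
    show "\<exists>\<delta>>0. \<forall>w. solves_on a \<epsilon> \<psi> {0..} w \<and> \<bar>w 0 - vs 0\<bar> < \<delta> \<longrightarrow> ((\<lambda>t. w t - vs t) \<longlongrightarrow> 0) at_top"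
    proof (intro exI[of _ "R / 8"] conjI allI impI)
      fix w assume w: "solves_on a \<epsilon> \<psi> {0..} w \<and> \<bar>w 0 - vs 0\<bar> < R / 8"
      define D where "D = C * \<bar>w 0 - vs 0\<bar>"
      \<comment> \<open>A majorant weaker than the geometric one, using only
        \<open>n + 1 \<le> 2 ^ n\<close>, already tends to 0.\<close>
      have "\<bar>w t - vs t\<bar> \<le> 4 * D / t" if t: "1 \<le> t" for t
      proof -
        define n where "n = nat \<lfloor>t / 4\<rfloor>"
        have "t / 4 \<le> real n + 1" using t unfolding n_def by linarith
        also have "\<dots> \<le> 2 ^ n" by (induction n) auto
        finally have "(1/2) ^ n \<le> 4 / t" using t by (simp add: field_simps)
        then have "C * ((1/2) ^ n * \<bar>w 0 - vs 0\<bar>) \<le> C * (4 / t * \<bar>w 0 - vs 0\<bar>)"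
          using C by (intro mult_left_mono mult_right_mono) auto
        then show ?thesis using dec[of w t] w t by (simp add: n_def D_def mult_ac)
      qed
      then have "eventually (\<lambda>t. norm (w t - vs t) \<le> 4 * D / t) at_top"
        unfolding real_norm_def by (intro eventually_mono[OF eventually_ge_at_top[of 1]])
      moreover have "((\<lambda>t. 4 * D / t) \<longlongrightarrow> 0) at_top"
        by (intro tendsto_divide_0[OF tendsto_const] filterlim_at_top_imp_at_infinity filterlim_ident)
      ultimately show "((\<lambda>t. w t - vs t) \<longlongrightarrow> 0) at_top"
        by (rule Lim_null_comparison)
    qed (use R_pos in auto)
  qed
qed

end

theorem theorem6:
  fixes \<psi> :: "real \<Rightarrow> real"
  assumes "transition_fn \<psi>"
  shows "\<exists>a1>0. \<forall>a>a1. \<exists>\<epsilon>0>0. \<exists>K>0. \<exists>c>0. \<exists>L>0. \<exists>t1 t2.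
           0 \<le> t1 \<and> t1 < t2 \<and> t2 \<le> 4 \<and>
           (\<forall>\<epsilon>. 0 < \<epsilon> \<and> \<epsilon> < \<epsilon>0 \<longrightarrow>
             (\<exists>vs. solves_on a \<epsilon> \<psi> {0..} vs \<and>
                (\<forall>t\<ge>0. vs (t + 4) = vs t) \<and>
                \<comment> \<open>sliding: on [t1,t2] the solution lies in the layer, O(eps)-close to Lambda_0^L\<close>
                (\<forall>t\<in>{t1..t2}. \<bar>vs t\<bar> < 1 \<and>
                   (\<exists>u. (t, u) \<in> crit_manifold \<psi> \<and> \<bar>vs t - u\<bar> \<le> K * \<epsilon>)) \<and>
                loc_asym_stable a \<epsilon> \<psi> vs \<and>
                \<comment> \<open>Poincare map is Lipschitz near the fixed point with constant L * exp(-c/eps)\<close>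
                (\<exists>\<delta>>0. \<forall>u w. \<bar>u - vs 0\<bar> < \<delta> \<and> \<bar>w - vs 0\<bar> < \<delta> \<longrightarrow>
                   \<bar>poincare a \<epsilon> \<psi> u - poincare a \<epsilon> \<psi> w\<bar> \<le> L * exp (- c / \<epsilon>) * \<bar>u - w\<bar>)))"
proof -
  obtain \<psi>1 M m ql qr where "transition \<psi> \<psi>1 M m ql qr"
    using transition_fn_imp_transition[OF assms] .
  then interpret transition \<psi> \<psi>1 M m ql qr .
  show ?thesis
  proof (rule exI[of _ 2560], intro conjI allI impI)
    fix a :: real assume a: "2560 < a"
    \<comment> \<open>This is \<open>7 / \<delta>\<close> written out: \<open>\<delta>\<close>
      depends on \<open>a\<close> alone, so \<open>L\<close> can be fixed before
      \<open>\<epsilon>\<close>.\<close>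
    define L where "L = 7 / (exp (- 3 * a) / 128)"
    define c where "c = m / 8"
    \<comment> \<open>The first bound is \<open>eps_le\<close>. The second gives
      \<open>contracting\<close>, because
      \<open>exp (- c / \<epsilon>) \<le> \<epsilon> / c\<close>.\<close>
    define \<epsilon>0 where "\<epsilon>0 = min (exp (- 3 * a) / (64 * a)) (c / (2 * L))"
    define C where "C = 2 * (M * a + 32) / m / m"
    have pos: "0 < L" "0 < c" using m_pos by (auto simp: L_def c_def)
    have pos': "0 < \<epsilon>0" using pos a by (simp add: \<epsilon>0_def)
    have C: "0 < C"
      unfolding C_def using M_pos m_pos a by (intro divide_pos_pos mult_pos_pos add_pos_pos) auto
    have main: "\<exists>vs. solves_on a \<epsilon> \<psi> {0..} vs \<and> (\<forall>t\<ge>0. vs (t + 4) = vs t) \<and>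
        (\<forall>t\<in>{3..19/6}. \<bar>vs t\<bar> < 1 \<and> (\<exists>u. (t, u) \<in> crit_manifold \<psi> \<and> \<bar>vs t - u\<bar> \<le> C * \<epsilon>)) \<and>
        loc_asym_stable a \<epsilon> \<psi> vs \<and>
        (\<exists>\<delta>>0. \<forall>u w. \<bar>u - vs 0\<bar> < \<delta> \<and> \<bar>w - vs 0\<bar> < \<delta> \<longrightarrow>
           \<bar>poincare a \<epsilon> \<psi> u - poincare a \<epsilon> \<psi> w\<bar> \<le> L * exp (- c / \<epsilon>) * \<bar>u - w\<bar>)"
      if \<epsilon>: "0 < \<epsilon> \<and> \<epsilon> < \<epsilon>0" for \<epsilon>
    proof -
      interpret flow \<psi> \<psi>1 M m ql qr a \<epsilon>
        by unfold_locales (use a \<epsilon> in \<open>auto simp: \<epsilon>0_def\<close>)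
      have L: "L = 7 / \<delta>" by (simp add: L_def \<delta>_def)
      have "c / \<epsilon> \<le> exp (c / \<epsilon>)" using exp_ge_add_one_self[of "c / \<epsilon>"] by linarith
      then have "exp (- c / \<epsilon>) \<le> \<epsilon> / c" using \<epsilon> pos by (simp add: exp_minus field_simps)
      also have "\<dots> \<le> 1 / (2 * L)" using \<epsilon> pos by (auto simp: \<epsilon>0_def field_simps)
      finally have "L * exp (- c / \<epsilon>) \<le> 1/2" using pos by (simp add: field_simps)
      then interpret contracting_flow \<psi> \<psi>1 M m ql qr a \<epsilon>
        by unfold_locales (simp add: L c_def)
      obtain vs where vs: "solves_on a \<epsilon> \<psi> {0..} vs" "\<And>t. 0 \<le> t \<Longrightarrow> vs (t + 4) = vs t" "\<bar>vs 0\<bar> \<le> 7/8 * R"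
        using periodic_solution by blast
      have tr: "trajectory vs" using vs R_pos by (intro trajectoryI) auto
      have C: "C = K / m" by (simp add: C_def K_def)
      have sliding: "\<forall>t\<in>{3..19/6}. \<bar>vs t\<bar> < 1 \<and> (\<exists>u. (t, u) \<in> crit_manifold \<psi> \<and> \<bar>vs t - u\<bar> \<le> C * \<epsilon>)"
        unfolding C by (intro ballI conjI slides[OF tr]) simp_all
      have return: "\<exists>\<delta>>0. \<forall>u w. \<bar>u - vs 0\<bar> < \<delta> \<and> \<bar>w - vs 0\<bar> < \<delta> \<longrightarrow>
           \<bar>poincare a \<epsilon> \<psi> u - poincare a \<epsilon> \<psi> w\<bar> \<le> L * exp (- c / \<epsilon>) * \<bar>u - w\<bar>"
      proof (intro exI[of _ "R / 8"] conjI allI impI)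
        fix u w assume "\<bar>u - vs 0\<bar> < R / 8 \<and> \<bar>w - vs 0\<bar> < R / 8"
        then have "\<bar>u\<bar> \<le> R" "\<bar>w\<bar> \<le> R" using vs(3) by linarith+
        then show "\<bar>poincare a \<epsilon> \<psi> u - poincare a \<epsilon> \<psi> w\<bar> \<le> L * exp (- c / \<epsilon>) * \<bar>u - w\<bar>"
          unfolding L c_def by (rule poincare_lipschitz)
      qed (use R_pos in simp)
      show ?thesis
        by (intro exI[of _ vs] conjI allI impI vs(1,2) sliding stable[OF vs(1,3)] return)
    qed
    show "\<exists>\<epsilon>0>0. \<exists>K>0. \<exists>c>0. \<exists>L>0. \<exists>t1 t2.
           0 \<le> t1 \<and> t1 < t2 \<and> t2 \<le> 4 \<and>
           (\<forall>\<epsilon>. 0 < \<epsilon> \<and> \<epsilon> < \<epsilon>0 \<longrightarrow>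
             (\<exists>vs. solves_on a \<epsilon> \<psi> {0..} vs \<and>
                (\<forall>t\<ge>0. vs (t + 4) = vs t) \<and>
                (\<forall>t\<in>{t1..t2}. \<bar>vs t\<bar> < 1 \<and>
                   (\<exists>u. (t, u) \<in> crit_manifold \<psi> \<and> \<bar>vs t - u\<bar> \<le> K * \<epsilon>)) \<and>
                loc_asym_stable a \<epsilon> \<psi> vs \<and>
                (\<exists>\<delta>>0. \<forall>u w. \<bar>u - vs 0\<bar> < \<delta> \<and> \<bar>w - vs 0\<bar> < \<delta> \<longrightarrow>
                   \<bar>poincare a \<epsilon> \<psi> u - poincare a \<epsilon> \<psi> w\<bar> \<le> L * exp (- c / \<epsilon>) * \<bar>u - w\<bar>)))"
    proof (rule exI[of _ \<epsilon>0], rule conjI[OF pos'], rule exI[of _ C], rule conjI[OF C],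
        rule exI[of _ c], rule conjI[OF pos(2)], rule exI[of _ L], rule conjI[OF pos(1)],
        rule exI[of _ 3], rule exI[of _ "19/6"], intro conjI allI impI main)
    qed simp_all
  qed simp
qed

end
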